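(* Assume $\operatorname{Ker}\Phi\cap\operatorname{Ker}D^*=\{0\}$ and fix $\lambda>0$. Let $y=\Phi x_0+w$ with $w\sim\mathcal{N}(0,\sigma^2\operatorname{Id}_Q)$. Then $y\mapsto\mu^\star_\lambda(y)$ is weakly differentiable and, for $y\notin\mathcal{H}_{\cdot,\lambda}$, with $x^\star_\lambda(y)$ any solution of $(\mathcal{P}_\lambda(y))$ and $J$ the $D$-cosupport of any solution of $(\mathcal{P}_\lambda(y))$ such that $(H_J)$ holds, $$\mathrm{GSURE}_\Phi(x^\star_\lambda(y))=\|y-\mu^\star_\lambda(y)\|_2^2-Q\sigma^2+2\sigma^2d(y),$$ $$\mathrm{GSURE}_\Pi(x^\star_\lambda(y))=\|x_{ML}(y)-\Pi x^\star_\lambda(y)\|_2^2-\sigma^2\operatorname{tr}((\Phi\Phi^* )^+)+2\sigma^2\operatorname{tr}(\Pi A^{[J]}),$$ and, when $\Phi$ has full (column) rank $N$, $$\mathrm{GSURE}_{\operatorname{Id}}(x^\star_\lambda(y))=\|x_{ML}(y)-x^\star_\lambda(y)\|_2^2-\sigma^2\operatorname{tr}((\Phi^*\Phi)^{-1})+2\sigma^2\operatorname{tr}(A^{[J]}).$$ Moreover, $d(y)$ is an unbiased estimator of the degrees of freedom of $(\mathcal{P}_\lambda(y))$, i.e. $df_\lambda=df^{\operatorname{Id}}_\lambda=\mathbb{E}_w\,d(y)$.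
   Context: $\Phi\in\mathbb{R}^{Q\times N}$; $D=(d_i)_{i=1}^P$ is a dictionary of atoms $d_i\in\mathbb{R}^N$, identified with the $N\times P$ matrix with columns $d_i$; $x_0\in\mathbb{R}^N$ is fixed; $\sigma>0$. $M^*$ is the adjoint (transpose), $M^+$ the Moore–Penrose pseudoinverse, $\operatorname{Id}$ the identity, $\mathbb{R}_+=[0,\infty)$. For $y\in\mathbb{R}^Q$, $\lambda>0$, $(\mathcal{P}_\lambda(y))$ is the problem of minimizing over $x\in\mathbb{R}^N$ the function $\frac12\|y-\Phi x\|_2^2+\lambda\|D^*x\|_1$; a solution is a global minimizer. All solutions have the same image under $\Phi$, and $\mu^\star_\lambda(y)=\Phi x^\star_\lambda(y)$ denotes it. For $J\subset\{1,\dots,P\}$, $J^c$ is its complement, $D_J$ the submatrix of $D$ with columns indexed by $J$ (with $\operatorname{Im}D_\emptyset=\{0\}$). The $D$-cosupport of $x$ is $\{i:(D^*x)_i=0\}$. $\mathcal{G}_J=\operatorname{Ker}D_J^*$. Condition $(H_J)$: $\operatorname{Ker}\Phi\cap\mathcal{G}_J=\{0\}$. When $(H_J)$ holds, $A^{[J]}=U_J(U_J^*\Phi^*\Phi U_J)^{-1}U_J^*$ with $U_J$ a matrix whose columns form a basis of $\mathcal{G}_J$ (and $A^{[J]}=0$ if $\mathcal{G}_J=\{0\}$), $\tilde\Pi^{[J]}=\Phi^*(\Phi A^{[J]}\Phi^*-\operatorname{Id})$, $\tilde\Omega^{[J]}=(\Phi^*\Phi A^{[J]}-\operatorname{Id})D_{J^c}$.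 $\operatorname{P}_{\mathcal{G}}$ is the orthogonal projector on $\mathcal{G}$. Let $$\mathcal{H}=\bigcup_{J\subset\{1,\dots,P\},\,(H_J)\text{ holds}}\ \bigcup_{K\subset J,\ \operatorname{Im}\tilde\Pi^{[J]}\not\subseteq\operatorname{Im}D_{J\setminus K}}\ \bigcup_{s_{J^c}\in\{-1,1\}^{|J^c|}}\ \bigcup_{\sigma_K\in\{-1,1\}^{|K|}}\mathcal{H}_{J,K,s_{J^c},\sigma_K},$$ $$\mathcal{H}_{J,K,s_{J^c},\sigma_K}=\{(y,\lambda)\in\mathbb{R}^Q\times\mathbb{R}_+:\ \operatorname{P}_{\mathcal{G}_{J\setminus K}}\tilde\Pi^{[J]}y=\lambda\operatorname{P}_{\mathcal{G}_{J\setminus K}}(\tilde\Omega^{[J]}s_{J^c}-D_K\sigma_K)\},$$ and $\mathcal{H}_{\cdot,\lambda}=\{y\in\mathbb{R}^Q:(y,\lambda)\in\mathcal{H}\}$, which has Lebesgue measure zero. For $y\notin\mathcal{H}_{\cdot,\lambda}$ there exists a solution of $(\mathcal{P}_\lambda(y))$ whose $D$-cosupport $J$ satisfies $(H_J)$, and $d(y)=\dim\mathcal{G}_J$ where $J$ is the $D$-cosupport of any such solution. For a matrix $A$ with $Q$ columns, $$\mathrm{GSURE}^A(x^\star_\lambda(y))=\|A(y-\mu^\star_\lambda(y))\|_2^2-\sigma^2\operatorname{tr}(A^*A)+2\sigma^2\operatorname{tr}\left(A\frac{\partial\mu^\star_\lambda(y)}{\partial y}A^*\right).$$ $\mathrm{GSURE}_\Phi$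 is $\mathrm{GSURE}^A$ with $A=\operatorname{Id}$; $\mathrm{GSURE}_\Pi$ is $\mathrm{GSURE}^A$ with $A=\Phi^*(\Phi\Phi^* )^+$ (used when $\Phi$ is rank deficient); $\mathrm{GSURE}_{\operatorname{Id}}$ is $\mathrm{GSURE}^A$ with $A=(\Phi^*\Phi)^{-1}\Phi^*$ (when $\Phi$ has full rank, so that $\Phi^*\Phi$ is invertible). $\Pi=\Phi^*(\Phi\Phi^* )^+\Phi$ is the orthogonal projector on $\operatorname{Ker}(\Phi)^\perp$. In the formula for $\mathrm{GSURE}_\Pi$, $x_{ML}(y)=\Phi^*(\Phi\Phi^* )^+y$; in that for $\mathrm{GSURE}_{\operatorname{Id}}$, $x_{ML}(y)=(\Phi^*\Phi)^{-1}\Phi^*y$. The degrees of freedom are $df_\lambda=df^{\operatorname{Id}}_\lambda=\sum_{i=1}^Q\operatorname{cov}_w(y_i,(\mu^\star_\lambda(y))_i)/\sigma^2$. *)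

theory Defs
  imports "HOL-Probability.Probability"
begin

section \<open>Linear algebra\<close>

definition pinv :: "real^'n^'m \<Rightarrow> real^'m^'n" where
  "pinv M = (THE X. M ** X ** M = M \<and> X ** M ** X = X \<and>
     transpose (M ** X) = M ** X \<and> transpose (X ** M) = X ** M)"

definition orth_proj :: "(real^'n) set \<Rightarrow> real^'n \<Rightarrow> real^'n" where
  "orth_proj G x = (THE p. p \<in> G \<and> (\<forall>g\<in>G. orthogonal (x - p) g))"

definition matrix_ker :: "real^'n^'m \<Rightarrow> (real^'n) set" where
  "matrix_ker M = {x. M *v x = 0}"

definition matrix_im :: "real^'n^'m \<Rightarrow> (real^'m) set" where
  "matrix_im M = range (\<lambda>x. M *v x)"

text \<open>A matrix whose set of columns is a subset \<open>J\<close> of a given index type is encoded by padding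
  with zero columns outside \<open>J\<close>. This changes neither the image of the matrix nor the kernel
  of its transpose. Vectors indexed by \<open>J\<close> are likewise padded with zeros.\<close>

definition cols :: "real^'p^'n \<Rightarrow> 'p set \<Rightarrow> real^'p^'n" where
  "cols D J = (\<chi> i j. if j \<in> J then D $ i $ j else 0)"

definition sign_vectors :: "'p set \<Rightarrow> (real^'p) set" where
  "sign_vectors J = {s. (\<forall>i\<in>J. s $ i \<in> {-1, 1}) \<and> (\<forall>i\<in>-J. s $ i = 0)}"

text \<open>The nonzero columns of \<open>U\<close>, which are those with index in \<open>I\<close>, form a basis of \<open>G\<close>.
  Since \<open>dim G \<le> CARD('n)\<close>, such \<open>I\<close> and \<open>U\<close> exist for every subspace \<open>G\<close>;
  \<open>I = {}\<close> and \<open>U = 0\<close> if \<open>G = {0}\<close>.\<close>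

definition basis_matrix :: "(real^'n) set \<Rightarrow> 'n set \<Rightarrow> real^'n^'n \<Rightarrow> bool" where
  "basis_matrix G I U \<longleftrightarrow>
     (\<forall>j\<in>-I. column j U = 0) \<and> inj_on (\<lambda>j. column j U) I \<and>
     independent ((\<lambda>j. column j U) ` I) \<and> span ((\<lambda>j. column j U) ` I) = G"

text \<open>The inverse of the square submatrix of \<open>M\<close> with rows and columns in \<open>I\<close>, padded with zeros.\<close>

definition block_inverse :: "'n set \<Rightarrow> real^'n^'n \<Rightarrow> real^'n^'n" where
  "block_inverse I M = (THE W.
     (\<forall>i j. i \<notin> I \<or> j \<notin> I \<longrightarrow> W $ i $ j = 0) \<and>
     (\<forall>i\<in>I. \<forall>j\<in>I. (\<Sum>k\<in>I. M $ i $ k * W $ k $ j) = (if i = j then 1 else 0)) \<and>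
     (\<forall>i\<in>I. \<forall>j\<in>I. (\<Sum>k\<in>I. W $ i $ k * M $ k $ j) = (if i = j then 1 else 0)))"


section \<open>The analysis-regularized least-squares problem\<close>

definition objective :: "real^'n^'q \<Rightarrow> real^'p^'n \<Rightarrow> real \<Rightarrow> real^'q \<Rightarrow> real^'n \<Rightarrow> real" where
  "objective \<Phi> D lam y x =
     (1/2) * (norm (y - \<Phi> *v x))\<^sup>2 + lam * (\<Sum>i\<in>UNIV. \<bar>(transpose D *v x) $ i\<bar>)"

definition is_solution :: "real^'n^'q \<Rightarrow> real^'p^'n \<Rightarrow> real \<Rightarrow> real^'q \<Rightarrow> real^'n \<Rightarrow> bool" where
  "is_solution \<Phi> D lam y x \<longleftrightarrow> (\<forall>z. objective \<Phi> D lam y x \<le> objective \<Phi> D lam y z)"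

text \<open>The common image under \<open>\<Phi>\<close> of all solutions.\<close>

definition mu_star :: "real^'n^'q \<Rightarrow> real^'p^'n \<Rightarrow> real \<Rightarrow> real^'q \<Rightarrow> real^'q" where
  "mu_star \<Phi> D lam y = (THE m. \<exists>x. is_solution \<Phi> D lam y x \<and> m = \<Phi> *v x)"

definition cosupport :: "real^'p^'n \<Rightarrow> real^'n \<Rightarrow> 'p set" where
  "cosupport D x = {i. (transpose D *v x) $ i = 0}"

definition cospace :: "real^'p^'n \<Rightarrow> 'p set \<Rightarrow> (real^'n) set" where
  "cospace D J = matrix_ker (transpose (cols D J))"

definition cond_H :: "real^'n^'q \<Rightarrow> real^'p^'n \<Rightarrow> 'p set \<Rightarrow> bool" where
  "cond_H \<Phi> D J \<longleftrightarrow> matrix_ker \<Phi> \<inter> cospace D J = {0}"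

text \<open>Under \<open>cond_H \<Phi> D J\<close>, the value of \<open>A_op\<close> does not depend on the chosen basis.\<close>

definition A_op :: "real^'n^'q \<Rightarrow> real^'p^'n \<Rightarrow> 'p set \<Rightarrow> real^'n^'n" where
  "A_op \<Phi> D J =
     (let (I, U) = (SOME (I, U). basis_matrix (cospace D J) I U)
      in U ** block_inverse I (transpose U ** transpose \<Phi> ** \<Phi> ** U) ** transpose U)"

definition Pi_tilde :: "real^'n^'q \<Rightarrow> real^'p^'n \<Rightarrow> 'p set \<Rightarrow> real^'q^'n" where
  "Pi_tilde \<Phi> D J = transpose \<Phi> ** (\<Phi> ** A_op \<Phi> D J ** transpose \<Phi> - mat 1)"

definition Omega_tilde :: "real^'n^'q \<Rightarrow> real^'p^'n \<Rightarrow> 'p set \<Rightarrow> real^'p^'n" where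
  "Omega_tilde \<Phi> D J = (transpose \<Phi> ** \<Phi> ** A_op \<Phi> D J - mat 1) ** cols D (-J)"


section \<open>The transition space\<close>

definition trans_piece ::
  "real^'n^'q \<Rightarrow> real^'p^'n \<Rightarrow> 'p set \<Rightarrow> 'p set \<Rightarrow> real^'p \<Rightarrow> real^'p \<Rightarrow> ((real^'q) \<times> real) set" where
  "trans_piece \<Phi> D J K s \<sigma>\<^sub>K = {(y, lam). 0 \<le> lam \<and>
     orth_proj (cospace D (J - K)) (Pi_tilde \<Phi> D J *v y) =
     lam *\<^sub>R orth_proj (cospace D (J - K)) (Omega_tilde \<Phi> D J *v s - cols D K *v \<sigma>\<^sub>K)}"

definition trans_space :: "real^'n^'q \<Rightarrow> real^'p^'n \<Rightarrow> ((real^'q) \<times> real) set" where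
  "trans_space \<Phi> D =
     (\<Union>J\<in>{J. cond_H \<Phi> D J}.
      \<Union>K\<in>{K. K \<subseteq> J \<and> \<not> matrix_im (Pi_tilde \<Phi> D J) \<subseteq> matrix_im (cols D (J - K))}.
      \<Union>s\<in>sign_vectors (-J). \<Union>\<sigma>\<^sub>K\<in>sign_vectors K. trans_piece \<Phi> D J K s \<sigma>\<^sub>K)"

definition trans_slice :: "real^'n^'q \<Rightarrow> real^'p^'n \<Rightarrow> real \<Rightarrow> (real^'q) set" where
  "trans_slice \<Phi> D lam = {y. (y, lam) \<in> trans_space \<Phi> D}"

text \<open>For \<open>y\<close> outside the null set \<open>trans_slice \<Phi> D lam\<close>, the dimension of the cospace is the same
  for all solutions whose cosupport satisfies \<open>cond_H\<close>. On the null set, where nothing is claimed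
  about this quantity, it is given the value 0, so that its expectation is taken of a function
  defined everywhere.\<close>

definition d_est :: "real^'n^'q \<Rightarrow> real^'p^'n \<Rightarrow> real \<Rightarrow> real^'q \<Rightarrow> nat" where
  "d_est \<Phi> D lam y =
     (if y \<in> trans_slice \<Phi> D lam then 0
      else (THE k. \<exists>x. is_solution \<Phi> D lam y x \<and> cond_H \<Phi> D (cosupport D x) \<and>
                       k = dim (cospace D (cosupport D x))))"


section \<open>Weak differentiability\<close>

text \<open>Test functions are the compactly supported \<open>C\<^sup>1\<close> functions, as in Evans and Gariepy.\<close>

definition test_function :: "(real^'q \<Rightarrow> real) \<Rightarrow> (real^'q \<Rightarrow> real^'q) \<Rightarrow> bool" where
  "test_function \<phi> g \<longleftrightarrow>
     (\<forall>x. GDERIV \<phi> x :> g x) \<and> continuous_on UNIV g \<and>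
     (\<exists>C. compact C \<and> (\<forall>x. x \<notin> C \<longrightarrow> \<phi> x = 0))"

definition locally_integrable :: "(real^'q \<Rightarrow> real) \<Rightarrow> bool" where
  "locally_integrable f \<longleftrightarrow> (\<forall>C. compact C \<longrightarrow> f absolutely_integrable_on C)"

definition has_weak_jacobian ::
  "(real^'q \<Rightarrow> real^'m) \<Rightarrow> (real^'q \<Rightarrow> real^'q^'m) \<Rightarrow> bool" where
  "has_weak_jacobian f G \<longleftrightarrow>
     (\<forall>i. locally_integrable (\<lambda>x. f x $ i)) \<and>
     (\<forall>i j. locally_integrable (\<lambda>x. G x $ i $ j)) \<and>
     (\<forall>i j \<phi> g. test_function \<phi> g \<longrightarrow>
        (LINT x|lebesgue. f x $ i * g x $ j) = - (LINT x|lebesgue. G x $ i $ j * \<phi> x))"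

definition weakly_differentiable :: "(real^'q \<Rightarrow> real^'m) \<Rightarrow> bool" where
  "weakly_differentiable f \<longleftrightarrow> (\<exists>G. has_weak_jacobian f G)"


section \<open>Risk estimation\<close>

definition gsure ::
  "real \<Rightarrow> real^'n^'q \<Rightarrow> real^'p^'n \<Rightarrow> real \<Rightarrow> real^'q^'m \<Rightarrow> real^'q \<Rightarrow> real" where
  "gsure \<sigma> \<Phi> D lam A y =
     (norm (A *v (y - mu_star \<Phi> D lam y)))\<^sup>2 - \<sigma>\<^sup>2 * trace (transpose A ** A)
     + 2 * \<sigma>\<^sup>2 * trace (A ** jacobian (mu_star \<Phi> D lam) (at y) ** transpose A)"

definition gsure_Phi ::
  "real \<Rightarrow> real^'n^'q \<Rightarrow> real^'p^'n \<Rightarrow> real \<Rightarrow> real^'q \<Rightarrow> real" where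
  "gsure_Phi \<sigma> \<Phi> D lam = gsure \<sigma> \<Phi> D lam (mat 1 :: real^'q^'q)"

definition gsure_Pi ::
  "real \<Rightarrow> real^'n^'q \<Rightarrow> real^'p^'n \<Rightarrow> real \<Rightarrow> real^'q \<Rightarrow> real" where
  "gsure_Pi \<sigma> \<Phi> D lam = gsure \<sigma> \<Phi> D lam (transpose \<Phi> ** pinv (\<Phi> ** transpose \<Phi>))"

definition gsure_Id ::
  "real \<Rightarrow> real^'n^'q \<Rightarrow> real^'p^'n \<Rightarrow> real \<Rightarrow> real^'q \<Rightarrow> real" where
  "gsure_Id \<sigma> \<Phi> D lam = gsure \<sigma> \<Phi> D lam (matrix_inv (transpose \<Phi> ** \<Phi>) ** transpose \<Phi>)"

definition proj_Pi :: "real^'n^'q \<Rightarrow> real^'n^'n" where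
  "proj_Pi \<Phi> = transpose \<Phi> ** pinv (\<Phi> ** transpose \<Phi>) ** \<Phi>"

text \<open>The centred normal distribution on \<open>real^'q\<close> with covariance matrix \<open>\<sigma>\<^sup>2 Id\<close>.\<close>

definition white_noise :: "'a measure \<Rightarrow> real \<Rightarrow> ('a \<Rightarrow> real^'q) \<Rightarrow> bool" where
  "white_noise M \<sigma> w \<longleftrightarrow>
     distributed M lborel w (\<lambda>v. ennreal (\<Prod>i\<in>UNIV. normal_density 0 \<sigma> (v $ i)))"

definition covariance :: "'a measure \<Rightarrow> ('a \<Rightarrow> real) \<Rightarrow> ('a \<Rightarrow> real) \<Rightarrow> real" where
  "covariance M X Y =
     (LINT \<omega>|M. (X \<omega> - (LINT \<omega>'|M. X \<omega>')) * (Y \<omega> - (LINT \<omega>'|M. Y \<omega>')))"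

text \<open>The Bochner integral of a non-integrable function is 0, so well-definedness of a covariance
  has to be expressed separately.\<close>

definition covariance_exists :: "'a measure \<Rightarrow> ('a \<Rightarrow> real) \<Rightarrow> ('a \<Rightarrow> real) \<Rightarrow> bool" where
  "covariance_exists M X Y \<longleftrightarrow>
     integrable M X \<and> integrable M Y \<and> integrable M (\<lambda>\<omega>. X \<omega> * Y \<omega>)"

definition degrees_of_freedom ::
  "'a measure \<Rightarrow> real \<Rightarrow> ('a \<Rightarrow> real^'q) \<Rightarrow> (real^'q \<Rightarrow> real^'q) \<Rightarrow> real" where
  "degrees_of_freedom M \<sigma> Y \<mu> =
     (\<Sum>i\<in>UNIV. covariance M (\<lambda>\<omega>. Y \<omega> $ i) (\<lambda>\<omega>. \<mu> (Y \<omega>) $ i) / \<sigma>\<^sup>2)"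

definition unbiased_estimator :: "'a measure \<Rightarrow> ('a \<Rightarrow> real) \<Rightarrow> real \<Rightarrow> bool" where
  "unbiased_estimator M T \<theta> \<longleftrightarrow> integrable M T \<and> (LINT \<omega>|M. T \<omega>) = \<theta>"

end

theory Submission
  imports Defs
begin

text \<open>
  Write \<open>A\<close> for \<open>A_op \<Phi> D J\<close>, with \<open>J\<close> the cosupport of a solution. The whole statement rests on
  one fact: for \<open>y\<close> outside the transition slice, the prediction \<open>mu_star\<close> agrees near \<open>y\<close> with an
  affine map whose linear part is \<open>\<Phi> A \<Phi>\<^sup>T\<close>, the orthogonal projector on the image under \<open>\<Phi>\<close> of the
  cospace.

  To see this, take a solution \<open>x\<close> whose cosupport \<open>J\<close> satisfies \<open>cond_H\<close>; a solution with the largest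
  possible cosupport has this property (\<open>solution_cond_H_exists\<close>). A separation argument gives a
  multiplier \<open>v\<close> in the subdifferential of the \<open>l\<^sup>1\<close> norm at \<open>D\<^sup>T x\<close> with
  \<open>\<Phi>\<^sup>T (y - \<Phi> x) = lam D v\<close> (\<open>solution_multiplier\<close>). Let \<open>K\<close> be the set of those \<open>i\<close> in \<open>J\<close> where the
  multiplier is saturated, \<open>\<bar>v\<^sub>i\<bar> = 1\<close>. The optimality condition projected on the cospace of \<open>J - K\<close> is
  exactly the equation of a piece of the transition space. As \<open>y\<close> avoids the slice, this piece
  cannot occur in it, that is, the range of \<open>Pi_tilde\<close> lies in the range of the columns of \<open>D\<close> in
  \<open>J - K\<close>. A small change of \<open>y\<close> can then be compensated by changing only the unsaturated multipliers,
  with the signs off \<open>J\<close> and the saturated entries kept. What remains to be satisfied are strict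
  inequalities, which persist near \<open>y\<close>, and so the explicit affine candidate stays a solution
  (\<open>mu_star_locally_affine\<close>).

  The slice is a finite union of proper affine subspaces, so it is closed and null. The prediction
  is nonexpansive, because the optimality conditions are monotone. A Lipschitz map that is \<open>C\<^sup>1\<close> off
  a closed null set has its pointwise Jacobian as weak Jacobian: move difference quotients from one
  factor of the integral to the other by translation invariance, and pass to the limit by dominated
  convergence (\<open>integration_by_parts_direction\<close>). The same lemma, applied to the Gaussian
  density instead of a test function, is Stein's identity. It turns the covariances in the degrees of
  freedom into the expectation of the trace of the Jacobian, which is
  \<open>tr (\<Phi> A \<Phi>\<^sup>T) = dim (cospace D J)\<close>. The three risk formulas are trace identities for the
  Jacobian \<open>\<Phi> A \<Phi>\<^sup>T\<close>.
\<close>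

section \<open>Cospaces and orthogonal projections\<close>

text \<open>The library's simplifier rule rewrites \<open>transpose A *v x\<close> to \<open>x v* A\<close>. Here adjoints are moved
  across inner products all the time, so the transpose is kept visible.\<close>

declare transpose_matrix_vector [simp del]

lemma inner_transpose_mult:
  fixes A :: "real^'n^'m"
  shows "(transpose A *v x) \<bullet> y = x \<bullet> (A *v y)"
  by (simp add: transpose_matrix_vector dot_lmul_matrix)

lemma inner_mult_transpose:
  fixes A :: "real^'n^'m"
  shows "(A *v x) \<bullet> y = x \<bullet> (transpose A *v y)"
  by (metis inner_commute inner_transpose_mult)

lemma matrix_mult_distribs:
  fixes A B :: "real^'n^'m" and C C' :: "real^'k^'n"
  shows "(A + B) ** C = A ** C + B ** C" "(A - B) ** C = A ** C - B ** C"
    and "A ** (C + C') = A ** C + A ** C'" "A ** (C - C') = A ** C - A ** C'"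
  by (simp_all add: matrix_matrix_mult_def vec_eq_iff algebra_simps sum.distrib sum_subtractf)

lemma transpose_cols_mult:
  "(transpose (cols D J) *v x) $ j = (if j \<in> J then (transpose D *v x) $ j else 0)"
  for D :: "real^'p^'n"
  by (simp add: matrix_vector_mult_def transpose_def cols_def)

lemma cols_mult:
  "cols D J *v z = D *v (\<chi> j. if j \<in> J then z $ j else 0)"
  for D :: "real^'p^'n"
  by (simp add: matrix_vector_mult_def cols_def vec_eq_iff if_distrib if_distribR cong: if_cong)

lemma mem_cospace:
  "x \<in> cospace D J \<longleftrightarrow> (\<forall>j\<in>J. (transpose D *v x) $ j = 0)"
  by (auto simp: cospace_def matrix_ker_def vec_eq_iff transpose_cols_mult)

lemma subspace_cospace: "subspace (cospace D J)"
  by (auto simp: subspace_def mem_cospace matrix_vector_right_distrib matrix_vector_mult_scaleR)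

lemma inner_cols_cospace:
  assumes "g \<in> cospace D J"
  shows "(cols D J *v z) \<bullet> g = 0"
proof -
  have "transpose (cols D J) *v g = 0"
    using assms by (simp add: cospace_def matrix_ker_def)
  then show ?thesis by (simp add: inner_mult_transpose)
qed

text \<open>Split \<open>v\<close> orthogonally along the range of \<open>A\<close>: the remainder is orthogonal to every \<open>A *v x\<close>,
  hence is killed by the transpose.\<close>

lemma mem_range_matrix_iff:
  fixes A :: "real^'n^'m"
  shows "v \<in> matrix_im A \<longleftrightarrow> (\<forall>g\<in>matrix_ker (transpose A). v \<bullet> g = 0)"
proof
  assume "v \<in> matrix_im A"
  then show "\<forall>g\<in>matrix_ker (transpose A). v \<bullet> g = 0"
    by (auto simp: matrix_im_def matrix_ker_def inner_mult_transpose)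
next
  assume *: "\<forall>g\<in>matrix_ker (transpose A). v \<bullet> g = 0"
  have "subspace (matrix_im A)"
    unfolding matrix_im_def by (rule linear_subspace_image[OF matrix_vector_mul_linear subspace_UNIV])
  then have sp: "span (matrix_im A) = matrix_im A" by (simp add: span_eq_iff)
  obtain a z where az: "a \<in> span (matrix_im A)" "\<And>w. w \<in> span (matrix_im A) \<Longrightarrow> orthogonal z w"
    "v = a + z"
    by (rule orthogonal_subspace_decomp_exists[of "matrix_im A" v]) blast
  have "(transpose A *v z) \<bullet> x = 0" for x
    using az(2)[of "A *v x"] sp by (simp add: inner_transpose_mult orthogonal_def matrix_im_def span_base)
  then have "transpose A *v z = 0" by (metis inner_eq_zero_iff)
  then have "v \<bullet> z = 0" using * by (simp add: matrix_ker_def)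
  moreover have "a \<bullet> z = 0" using az(1,2) by (simp add: orthogonal_def inner_commute)
  ultimately have "z = 0" using az(3) by (simp add: inner_add_left)
  then show "v \<in> matrix_im A" using az sp by simp
qed

lemma mem_range_cols_iff: "v \<in> matrix_im (cols D J) \<longleftrightarrow> (\<forall>g\<in>cospace D J. v \<bullet> g = 0)"
  by (simp add: mem_range_matrix_iff cospace_def)

lemma orth_proj_props:
  assumes "subspace G"
  shows "orth_proj G x \<in> G" "g \<in> G \<Longrightarrow> (x - orth_proj G x) \<bullet> g = 0"
proof -
  have sp: "span G = G" using assms by (simp add: span_eq_iff)
  obtain a z where az: "a \<in> span G" "\<And>w. w \<in> span G \<Longrightarrow> orthogonal z w" "x = a + z"
    by (rule orthogonal_subspace_decomp_exists[of G x]) blast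
  have P: "orth_proj G x \<in> G \<and> (\<forall>g\<in>G. orthogonal (x - orth_proj G x) g)"
    unfolding orth_proj_def
  proof (rule theI[of _ a])
    show "a \<in> G \<and> (\<forall>g\<in>G. orthogonal (x - a) g)" using az sp by auto
  next
    fix p assume p: "p \<in> G \<and> (\<forall>g\<in>G. orthogonal (x - p) g)"
    have "a - p \<in> G" using p az sp assms by (simp add: subspace_diff)
    then have "(x - p) \<bullet> (a - p) = 0" "z \<bullet> (a - p) = 0" using p az sp by (auto simp: orthogonal_def)
    then have "(a - p) \<bullet> (a - p) = 0" using az(3) by (simp add: algebra_simps)
    then show "p = a" by simp
  qed
  show "orth_proj G x \<in> G" using P by blast
  show "g \<in> G \<Longrightarrow> (x - orth_proj G x) \<bullet> g = 0" using P by (simp add: orthogonal_def)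
qed

text \<open>The transition pieces are defined by equations between projections. This form, a family of affine
  equations indexed by \<open>G\<close>, is what membership, closedness and negligibility are checked with.\<close>

lemma orth_proj_eq_scaleR_iff:
  assumes "subspace G"
  shows "orth_proj G u = c *\<^sub>R orth_proj G v \<longleftrightarrow> (\<forall>g\<in>G. (u - c *\<^sub>R v) \<bullet> g = 0)"
proof -
  let ?d = "orth_proj G u - c *\<^sub>R orth_proj G v"
  have d: "?d \<in> G"
    using assms orth_proj_props(1)[OF assms] by (simp add: subspace_diff subspace_scale)
  have eq: "?d \<bullet> g = (u - c *\<^sub>R v) \<bullet> g" if "g \<in> G" for g
    using orth_proj_props(2)[OF assms that, of u] orth_proj_props(2)[OF assms that, of v]
    by (simp add: inner_diff_left)
  show ?thesis
  proof
    assume "orth_proj G u = c *\<^sub>R orth_proj G v"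
    then show "\<forall>g\<in>G. (u - c *\<^sub>R v) \<bullet> g = 0" using eq by (metis diff_self inner_zero_left)
  next
    assume "\<forall>g\<in>G. (u - c *\<^sub>R v) \<bullet> g = 0"
    then have "?d \<bullet> ?d = 0" using eq[OF d] d by simp
    then show "orth_proj G u = c *\<^sub>R orth_proj G v" by simp
  qed
qed

section \<open>The operator of the restricted normal equation\<close>

text \<open>The diagonal projector on the coordinates outside \<open>I\<close>. It links blocks that are padded with zeros
  to inversion of full matrices: a padded block is invertible on \<open>I\<close> iff adding \<open>outside_id I\<close>
  makes it invertible, and \<open>mat 1 - outside_id I\<close> is the padded identity block.\<close>

definition outside_id :: "'n set \<Rightarrow> real^'n^'n" where
  "outside_id I = (\<chi> i j. if i = j \<and> i \<notin> I then 1 else 0)"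

lemma outside_id_mult_left: "(outside_id I ** X) $ i $ j = (if i \<in> I then 0 else X $ i $ j)"
  for X :: "real^'m^'n"
  by (simp add: outside_id_def matrix_matrix_mult_def if_distrib if_distribR cong: if_cong)

lemma outside_id_mult_right: "(X ** outside_id I) $ i $ j = (if j \<in> I then 0 else X $ i $ j)"
  for X :: "real^'n^'m"
proof -
  have "(X ** outside_id I) $ i $ j = (\<Sum>k\<in>UNIV. if k = j then (if j \<in> I then 0 else X $ i $ j) else 0)"
    unfolding matrix_matrix_mult_def outside_id_def
    by (simp only: vec_lambda_beta, rule sum.cong) auto
  then show ?thesis by simp
qed

lemma outside_id_vec: "(outside_id I *v x) $ i = (if i \<in> I then 0 else x $ i)"
  by (simp add: outside_id_def matrix_vector_mult_def if_distrib if_distribR cong: if_cong)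

lemma basis_matrix_exists:
  fixes G :: "(real^'n) set"
  assumes "subspace G"
  shows "\<exists>I U. basis_matrix G I U"
proof -
  obtain B where B: "B \<subseteq> G" "independent B" "G \<subseteq> span B" "card B = dim G"
    using basis_exists by blast
  have fB: "finite B" using B(2) independent_imp_finite by blast
  have "card B \<le> CARD('n)" using B(4) dim_subset_UNIV_cart by metis
  then obtain I :: "'n set" where I: "card I = card B"
    by (metis obtain_subset_with_card_n)
  then obtain f where f: "bij_betw f I B"
    using fB finite_same_card_bij[of I B] by auto
  define U :: "real^'n^'n" where "U = (\<chi> i j. if j \<in> I then f j $ i else 0)"
  have col: "column j U = (if j \<in> I then f j else 0)" for j
    by (simp add: U_def column_def vec_eq_iff)
  have im: "(\<lambda>j. column j U) ` I = B"
    using f by (auto simp: col bij_betw_def)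
  have "span B = G"
    using B assms by (simp add: span_minimal subset_antisym)
  moreover have "inj_on (\<lambda>j. column j U) I"
    using f by (auto simp: inj_on_def col bij_betw_def)
  ultimately have "basis_matrix G I U"
    using B(2) im by (auto simp: basis_matrix_def col)
  then show ?thesis by blast
qed

lemma basis_matrix_mult_in:
  assumes "basis_matrix G I U"
  shows "U *v x \<in> G"
proof -
  have "U *v x = (\<Sum>j\<in>UNIV. x $ j *\<^sub>R column j U)"
    by (simp add: matrix_mult_sum scalar_mult_eq_scaleR)
  also have "\<dots> \<in> span ((\<lambda>j. column j U) ` I)"
    using assms
    by (intro span_sum span_scale) (metis ComplI basis_matrix_def imageI span_base span_zero)
  finally show ?thesis using assms by (simp add: basis_matrix_def)
qed

lemma basis_matrix_represents:
  fixes U :: "real^'n^'n"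
  assumes "basis_matrix G I U" and "g \<in> G"
  obtains c where "g = U *v c" and "\<forall>j. j \<notin> I \<longrightarrow> c $ j = 0"
proof -
  let ?S = "(\<lambda>j. column j U) ` I"
  have inj: "inj_on (\<lambda>j. column j U) I" and g: "g \<in> span ?S" and fin: "finite ?S"
    using assms by (auto simp: basis_matrix_def)
  obtain u where u: "g = (\<Sum>v\<in>?S. u v *\<^sub>R v)"
    using g span_finite[OF fin] by auto
  define c :: "real^'n" where "c = (\<chi> j. if j \<in> I then u (column j U) else 0)"
  have "U *v c = (\<Sum>j\<in>UNIV. c $ j *\<^sub>R column j U)"
    by (simp add: matrix_mult_sum scalar_mult_eq_scaleR)
  also have "\<dots> = (\<Sum>j\<in>I. c $ j *\<^sub>R column j U)"
    by (rule sum.mono_neutral_right) (auto simp: c_def)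
  also have "\<dots> = g"
    unfolding u by (subst sum.reindex[OF inj]) (auto simp: c_def)
  finally show ?thesis using that[of c] by (auto simp: c_def)
qed

lemma basis_matrix_injective:
  assumes B: "basis_matrix G I U" and z: "U *v c = 0" and c: "\<forall>j. j \<notin> I \<longrightarrow> c $ j = 0"
  shows "c = 0"
proof -
  let ?S = "(\<lambda>j. column j U) ` I"
  have inj: "inj_on (\<lambda>j. column j U) I" and ind: "independent ?S" and fin: "finite ?S"
    using B by (auto simp: basis_matrix_def)
  define u where "u v = c $ (inv_into I (\<lambda>j. column j U) v)" for v
  have "(\<Sum>v\<in>?S. u v *\<^sub>R v) = (\<Sum>j\<in>I. c $ j *\<^sub>R column j U)"
    by (subst sum.reindex[OF inj]) (auto simp: u_def inv_into_f_f[OF inj])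
  also have "\<dots> = (\<Sum>j\<in>UNIV. c $ j *\<^sub>R column j U)"
    by (rule sum.mono_neutral_left) (use c in auto)
  also have "\<dots> = 0"
    using z by (simp add: matrix_mult_sum scalar_mult_eq_scaleR)
  finally have s0: "(\<Sum>v\<in>?S. u v *\<^sub>R v) = 0" .
  have "c $ j = 0" if "j \<in> I" for j
  proof -
    have "u (column j U) = 0"
      using independentD[OF ind fin subset_refl s0] that by blast
    then show ?thesis using that by (simp add: u_def inv_into_f_f[OF inj])
  qed
  then show ?thesis using c by (auto simp: vec_eq_iff)
qed

lemma basis_matrix_card:
  assumes "basis_matrix G I U"
  shows "card I = dim G"
proof -
  have "dim G = card ((\<lambda>j. column j U) ` I)"
    using assms unfolding basis_matrix_def by (metis dim_span_eq_card_independent)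
  then show ?thesis using assms by (simp add: basis_matrix_def card_image)
qed

text \<open>With \<open>E = outside_id I\<close>, the matrix \<open>N = M + E\<close> is injective and satisfies \<open>N E = E N = E\<close>.
  Subtracting \<open>E\<close> from its inverse therefore leaves a two-sided inverse of the block, padded
  with zeros; two such inverses agree by the usual computation.\<close>

lemma block_inverse_works:
  fixes M :: "real^'n^'n"
  assumes M0: "\<And>i j. i \<notin> I \<or> j \<notin> I \<Longrightarrow> M $ i $ j = 0"
    and inj: "\<And>c. M *v c = 0 \<Longrightarrow> (\<forall>j. j \<notin> I \<longrightarrow> c $ j = 0) \<Longrightarrow> c = 0"
  shows "M ** block_inverse I M = mat 1 - outside_id I"
    and "block_inverse I M ** M = mat 1 - outside_id I"
proof -
  let ?E = "outside_id I :: real^'n^'n"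
  let ?P = "\<lambda>W::real^'n^'n. (\<forall>i j. i \<notin> I \<or> j \<notin> I \<longrightarrow> W $ i $ j = 0) \<and>
     (\<forall>i\<in>I. \<forall>j\<in>I. (\<Sum>k\<in>I. M $ i $ k * W $ k $ j) = (if i = j then 1 else 0)) \<and>
     (\<forall>i\<in>I. \<forall>j\<in>I. (\<Sum>k\<in>I. W $ i $ k * M $ k $ j) = (if i = j then 1 else 0))"
  have sumI: "(X ** Y) $ i $ j = (\<Sum>k\<in>I. X $ i $ k * Y $ k $ j)"
    if "\<And>i j. i \<notin> I \<or> j \<notin> I \<Longrightarrow> X $ i $ j = 0" for X Y :: "real^'n^'n" and i j
    unfolding matrix_matrix_mult_def
    by (simp, rule sum.mono_neutral_right) (use that in auto)
  have sumM: "(M ** Y) $ i $ j = (\<Sum>k\<in>I. M $ i $ k * Y $ k $ j)" for Y :: "real^'n^'n" and i j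
    by (rule sumI) (rule M0)
  have P_iff: "?P W \<longleftrightarrow> (\<forall>i j. i \<notin> I \<or> j \<notin> I \<longrightarrow> W $ i $ j = 0) \<and> M ** W = mat 1 - ?E \<and> W ** M = mat 1 - ?E"
    for W
  proof (cases "\<forall>i j. i \<notin> I \<or> j \<notin> I \<longrightarrow> W $ i $ j = 0")
    case W: True
    have "(M ** W = mat 1 - ?E) \<longleftrightarrow>
        (\<forall>i\<in>I. \<forall>j\<in>I. (\<Sum>k\<in>I. M $ i $ k * W $ k $ j) = (if i = j then 1 else 0))"
      unfolding vec_eq_iff sumM
      using W M0 by (auto simp: mat_def outside_id_def)
        (metis (no_types, lifting) mult_eq_0_iff sum.neutral)
    moreover have "(W ** M = mat 1 - ?E) \<longleftrightarrow>
        (\<forall>i\<in>I. \<forall>j\<in>I. (\<Sum>k\<in>I. W $ i $ k * M $ k $ j) = (if i = j then 1 else 0))"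
    proof -
      have sumW: "(W ** Y) $ i $ j = (\<Sum>k\<in>I. W $ i $ k * Y $ k $ j)" for Y :: "real^'n^'n" and i j
        by (rule sumI) (use W in blast)
      show ?thesis
        unfolding vec_eq_iff sumW
        using W M0 by (auto simp: mat_def outside_id_def)
          (metis (no_types, lifting) mult_eq_0_iff sum.neutral)
    qed
    ultimately show ?thesis using W by blast
  qed blast
  have EE: "?E ** ?E = ?E" and ME: "M ** ?E = 0" and EM: "?E ** M = 0"
    using M0 by (simp_all add: vec_eq_iff outside_id_mult_left outside_id_mult_right)
      (simp_all add: outside_id_def)
  define N where "N = M + ?E"
  have NE: "N ** ?E = ?E" "?E ** N = ?E"
    by (simp_all add: N_def matrix_mult_distribs EE ME EM)
  have "c = 0" if "N *v c = 0" for c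
  proof -
    have "?E *v c = 0" using that
      by (metis NE(2) matrix_vector_mul_assoc matrix_vector_mult_0_right)
    then have 1: "\<forall>j. j \<notin> I \<longrightarrow> c $ j = 0"
      by (metis outside_id_vec zero_index)
    have "M *v c = 0" using that \<open>?E *v c = 0\<close> by (simp add: N_def matrix_vector_mult_add_rdistrib)
    then show "c = 0" using 1 inj by blast
  qed
  then obtain R where RN: "R ** N = mat 1" using matrix_left_invertible_ker by blast
  then have NR: "N ** R = mat 1" by (simp add: matrix_left_right_inverse)
  have RE: "R ** ?E = ?E"
  proof -
    have "R ** ?E = R ** (N ** ?E)" by (simp add: NE)
    then show ?thesis by (simp only: matrix_mul_assoc RN matrix_mul_lid)
  qed
  have ER: "?E ** R = ?E"
  proof -
    have "?E ** R = (?E ** N) ** R" by (simp add: NE)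
    then show ?thesis by (simp only: NR matrix_mul_rid flip: matrix_mul_assoc)
  qed
  define W where "W = R - ?E"
  have WE: "W ** ?E = 0" "?E ** W = 0"
    by (simp_all add: W_def matrix_mult_distribs RE ER EE)
  have W0: "\<forall>i j. i \<notin> I \<or> j \<notin> I \<longrightarrow> W $ i $ j = 0"
    using WE by (metis outside_id_mult_left outside_id_mult_right zero_index)
  have M_N: "M = N - ?E" by (simp add: N_def)
  have "M ** W = mat 1 - ?E" "W ** M = mat 1 - ?E"
    unfolding W_def M_N by (simp_all add: matrix_mult_distribs RE ER EE NE RN NR)
  then have PW: "?P W"
    unfolding P_iff using W0 by blast
  have "W' = W" if PW': "?P W'" for W'
  proof -
    have a: "W ** M = mat 1 - ?E" "M ** W' = mat 1 - ?E"
      using PW PW' unfolding P_iff by blast+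
    have b: "?E ** W' = 0"
    proof -
      have "W' $ i $ j = 0" if "i \<notin> I" for i j using PW' that by blast
      then show ?thesis by (simp add: vec_eq_iff outside_id_mult_left)
    qed
    have "W ** (M ** W') = (W ** M) ** W'" by (simp add: matrix_mul_assoc)
    then show ?thesis
      unfolding a by (simp add: matrix_mult_distribs b WE)
  qed
  then have "?P (block_inverse I M)"
    unfolding block_inverse_def by (rule theI[where P = ?P and a = W, OF PW])
  then show "M ** block_inverse I M = mat 1 - ?E" "block_inverse I M ** M = mat 1 - ?E"
    unfolding P_iff by blast+
qed

text \<open>The matrix \<open>U\<^sup>T \<Phi>\<^sup>T \<Phi> U\<close> is injective on vectors supported in \<open>I\<close>: a kernel vector \<open>c\<close> satisfies
  \<open>\<Phi> U c = 0\<close> with \<open>U c\<close> in the cospace, so \<open>U c = 0\<close> by \<open>cond_H\<close> and \<open>c = 0\<close> by independence of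
  the columns.\<close>

lemma A_op_obtain:
  fixes \<Phi> :: "real^'n^'q" and D :: "real^'p^'n"
  assumes "cond_H \<Phi> D J"
  obtains I U W where "basis_matrix (cospace D J) I U" "A_op \<Phi> D J = U ** W ** transpose U"
    "(transpose U ** transpose \<Phi> ** \<Phi> ** U) ** W = mat 1 - outside_id I"
    "W ** (transpose U ** transpose \<Phi> ** \<Phi> ** U) = mat 1 - outside_id I"
proof -
  obtain I U where IU: "(SOME (I, U). basis_matrix (cospace D J) I U) = (I, U)"
    by (cases "SOME (I, U). basis_matrix (cospace D J) I U") auto
  have "\<exists>z. case z of (I, U) \<Rightarrow> basis_matrix (cospace D J) I U"
    using basis_matrix_exists[OF subspace_cospace] by auto
  then have B: "basis_matrix (cospace D J) I U"
    using someI_ex[of "\<lambda>(I, U). basis_matrix (cospace D J) I U"] IU by auto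
  let ?M = "transpose U ** transpose \<Phi> ** \<Phi> ** U"
  have U0: "U $ i $ j = 0" if "j \<notin> I" for i j
  proof -
    have "column j U = 0" using B that by (simp add: basis_matrix_def)
    then show ?thesis by (metis column_def vec_lambda_beta zero_index)
  qed
  have M_eq: "?M = transpose U ** (transpose \<Phi> ** \<Phi> ** U)" by (simp add: matrix_mul_assoc)
  have 1: "?M $ i $ j = 0" if "i \<notin> I \<or> j \<notin> I" for i j
  proof (cases "i \<in> I")
    case True
    then have "j \<notin> I" using that by blast
    then show ?thesis by (simp add: matrix_matrix_mult_def U0)
  next
    case False
    then show ?thesis unfolding M_eq by (simp add: matrix_matrix_mult_def transpose_def U0)
  qed
  have 2: "c = 0" if "?M *v c = 0" and c: "\<forall>j. j \<notin> I \<longrightarrow> c $ j = 0" for c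
  proof -
    have "(\<Phi> *v (U *v c)) \<bullet> (\<Phi> *v (U *v c)) = (?M *v c) \<bullet> c"
      by (simp add: inner_transpose_mult flip: matrix_vector_mul_assoc)
    then have "\<Phi> *v (U *v c) = 0" using that by simp
    moreover have "U *v c \<in> cospace D J" by (rule basis_matrix_mult_in[OF B])
    ultimately have "U *v c = 0" using assms by (auto simp: cond_H_def matrix_ker_def)
    then show "c = 0" using basis_matrix_injective[OF B] c by blast
  qed
  show ?thesis
    by (rule that[OF B _ block_inverse_works[OF 1 2]]) (simp_all add: A_op_def IU)
qed

text \<open>The basis chosen in \<open>A_op\<close> is forgotten from here on. The operator solves the normal equation
  \<open>\<Phi>\<^sup>T \<Phi> x = v\<close> restricted to the cospace, and by cyclicity the trace counts the basis vectors.\<close>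

lemma
  fixes \<Phi> :: "real^'n^'q" and D :: "real^'p^'n"
  assumes H: "cond_H \<Phi> D J"
  shows A_op_in_cospace: "A_op \<Phi> D J *v v \<in> cospace D J"
    and A_op_normal_equation:
      "g \<in> cospace D J \<Longrightarrow> (\<Phi> *v (A_op \<Phi> D J *v v)) \<bullet> (\<Phi> *v g) = v \<bullet> g"
    and trace_A_op: "trace (\<Phi> ** A_op \<Phi> D J ** transpose \<Phi>) = real (dim (cospace D J))"
proof -
  from A_op_obtain[OF H] obtain I U W where B: "basis_matrix (cospace D J) I U"
    and A: "A_op \<Phi> D J = U ** W ** transpose U"
    and MW: "(transpose U ** transpose \<Phi> ** \<Phi> ** U) ** W = mat 1 - outside_id I"
    and WM: "W ** (transpose U ** transpose \<Phi> ** \<Phi> ** U) = mat 1 - outside_id I" .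
  show "A_op \<Phi> D J *v v \<in> cospace D J"
    using basis_matrix_mult_in[OF B] by (simp add: A flip: matrix_vector_mul_assoc)
  show "(\<Phi> *v (A_op \<Phi> D J *v v)) \<bullet> (\<Phi> *v g) = v \<bullet> g" if g: "g \<in> cospace D J"
  proof -
    obtain c where c: "g = U *v c" "\<forall>j. j \<notin> I \<longrightarrow> c $ j = 0"
      using basis_matrix_represents[OF B g] .
    then have Ec: "outside_id I *v c = 0" by (simp add: vec_eq_iff outside_id_vec)
    have TE: "transpose (outside_id I) = outside_id I"
      by (auto simp: transpose_def outside_id_def vec_eq_iff)
    have "(\<Phi> *v (A_op \<Phi> D J *v v)) \<bullet> (\<Phi> *v g)
        = ((transpose U ** transpose \<Phi> ** \<Phi> ** U) ** W *v (transpose U *v v)) \<bullet> c"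
      by (simp add: A c inner_transpose_mult flip: matrix_vector_mul_assoc)
    also have "\<dots> = (transpose U *v v) \<bullet> c - (outside_id I *v (transpose U *v v)) \<bullet> c"
      by (simp add: MW matrix_vector_mult_diff_rdistrib inner_diff_left)
    also have "(outside_id I *v (transpose U *v v)) \<bullet> c = 0"
      by (simp add: inner_mult_transpose TE Ec)
    finally show ?thesis by (simp add: inner_transpose_mult c)
  qed
  have "trace (\<Phi> ** A_op \<Phi> D J ** transpose \<Phi>) = trace ((\<Phi> ** U) ** (W ** transpose U ** transpose \<Phi>))"
    by (simp add: A matrix_mul_assoc)
  also have "\<dots> = trace (W ** (transpose U ** transpose \<Phi> ** \<Phi> ** U))"
    by (subst trace_mul_sym) (simp add: matrix_mul_assoc)
  also have "\<dots> = (\<Sum>i\<in>UNIV. if i \<in> I then 1 else 0)"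
    unfolding WM by (auto simp: trace_def outside_id_def mat_def intro!: sum.cong)
  also have "\<dots> = real (card I)" by (simp flip: sum.inter_filter)
  finally show "trace (\<Phi> ** A_op \<Phi> D J ** transpose \<Phi>) = real (dim (cospace D J))"
    by (simp add: basis_matrix_card[OF B])
qed

lemma A_op_unique:
  fixes \<Phi> :: "real^'n^'q" and D :: "real^'p^'n"
  assumes H: "cond_H \<Phi> D J" and x: "x \<in> cospace D J"
    and eq: "\<And>g. g \<in> cospace D J \<Longrightarrow> (\<Phi> *v x) \<bullet> (\<Phi> *v g) = v \<bullet> g"
  shows "x = A_op \<Phi> D J *v v"
proof -
  let ?d = "x - A_op \<Phi> D J *v v"
  have d: "?d \<in> cospace D J"
    by (intro subspace_diff subspace_cospace x A_op_in_cospace H)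
  have "(\<Phi> *v ?d) \<bullet> (\<Phi> *v ?d) = 0"
    using eq[OF d] A_op_normal_equation[OF H d, of v]
    by (simp add: matrix_vector_mult_diff_distrib inner_diff_left)
  then have "\<Phi> *v ?d = 0" by (simp only: inner_eq_zero_iff)
  then have "?d \<in> matrix_ker \<Phi> \<inter> cospace D J" using d by (simp only: matrix_ker_def IntI mem_Collect_eq)
  then have "?d = 0" using H by (simp only: cond_H_def singleton_iff)
  then show ?thesis by simp
qed

section \<open>The pseudoinverse of a symmetric matrix\<close>

text \<open>A symmetric matrix has the same range as its square, because \<open>b = S c + z\<close> with \<open>z\<close> orthogonal to
  the range of \<open>S\<close> means \<open>S z = 0\<close>. Solving \<open>S b = S (S c)\<close> for the unit vectors \<open>b\<close> gives the columns
  of \<open>X\<close>.\<close>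

lemma symmetric_matrix_decomposition:
  fixes S :: "real^'n^'n"
  assumes "transpose S = S"
  shows "\<exists>X. S = S ** S ** X"
proof -
  have "\<exists>c. S *v b = S *v (S *v c)" for b
  proof -
    obtain a z where az: "a \<in> span (matrix_im S)" "\<And>w. w \<in> span (matrix_im S) \<Longrightarrow> orthogonal z w"
      "b = a + z"
      by (rule orthogonal_subspace_decomp_exists[of "matrix_im S" b]) blast
    have "subspace (matrix_im S)"
      unfolding matrix_im_def by (rule linear_subspace_image[OF matrix_vector_mul_linear subspace_UNIV])
    then have "a \<in> matrix_im S" using az(1) by (simp add: span_eq_iff[THEN iffD2])
    then obtain c where c: "a = S *v c" by (auto simp: matrix_im_def)
    have "(S *v z) \<bullet> x = 0" for x
      using az(2)[of "S *v x"] assms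
      by (metis inner_mult_transpose matrix_im_def orthogonal_def rangeI span_base)
    then have "S *v z = 0" by (metis inner_eq_zero_iff)
    then show ?thesis using az(3) c by (auto simp: matrix_vector_right_distrib)
  qed
  then obtain f where f: "\<And>b. S *v b = S *v (S *v f b)" by metis
  define X :: "real^'n^'n" where "X = transpose (\<chi> j. f (axis j 1))"
  have "S ** S ** X *v axis j 1 = S *v axis j 1" for j
  proof -
    have "X *v axis j 1 = f (axis j 1)"
      by (simp add: X_def matrix_vector_mult_basis column_def transpose_def vec_eq_iff)
    then show ?thesis using f by (simp flip: matrix_vector_mul_assoc)
  qed
  then have "column j S = column j (S ** S ** X)" for j by (metis matrix_vector_mult_basis)
  then have "S = S ** S ** X" by (simp add: vec_eq_iff column_def)
  then show ?thesis by blast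
qed

lemma moore_penrose_unique:
  fixes S X Y :: "real^'n^'n"
  assumes "S ** X ** S = S" "X ** S ** X = X" "transpose (S ** X) = S ** X" "transpose (X ** S) = X ** S"
    and "S ** Y ** S = S" "Y ** S ** Y = Y" "transpose (S ** Y) = S ** Y" "transpose (Y ** S) = Y ** S"
  shows "X = Y"
proof -
  have 1: "S ** X = S ** Y"
  proof -
    have "S ** X = transpose (S ** X)" using assms by simp
    also have "\<dots> = transpose ((S ** Y) ** (S ** X))" by (simp add: assms(5) matrix_mul_assoc)
    also have "\<dots> = (S ** X) ** (S ** Y)" by (simp add: matrix_transpose_mul[of "S ** Y"] assms)
    also have "\<dots> = S ** Y" by (simp add: assms(1) matrix_mul_assoc)
    finally show ?thesis .
  qed
  have 2: "X ** S = Y ** S"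
  proof -
    have "X ** S = transpose (X ** S)" using assms by simp
    also have "\<dots> = transpose ((X ** S) ** (Y ** S))" by (metis assms(5) matrix_mul_assoc)
    also have "\<dots> = (Y ** S) ** (X ** S)" by (simp add: matrix_transpose_mul[of "X ** S"] assms)
    also have "\<dots> = Y ** S" by (metis assms(1) matrix_mul_assoc)
    finally show ?thesis .
  qed
  have "X = X ** (S ** X)" by (metis assms(2) matrix_mul_assoc)
  also have "\<dots> = (Y ** S) ** Y" by (metis 1 2 matrix_mul_assoc)
  finally show ?thesis using assms(6) by simp
qed

text \<open>From \<open>S = S S X\<close> and its transpose, \<open>e = S X = X\<^sup>T S\<close> is a symmetric idempotent that is neutral for
  \<open>S\<close>. Then \<open>X\<^sup>T S X\<close>, the group inverse of \<open>S\<close>, satisfies the four Penrose equations with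
  both products equal to \<open>e\<close>, and it is visibly symmetric.\<close>

lemma
  fixes S :: "real^'n^'n"
  assumes S: "transpose S = S"
  shows pinv_symmetric: "transpose (pinv S) = pinv S"
    and pinv_mult_mult: "pinv S ** S ** pinv S = pinv S"
proof -
  obtain X where X: "S = S ** S ** X" using symmetric_matrix_decomposition[OF S] by blast
  have Y: "S = transpose X ** S ** S"
    using arg_cong[OF X, of transpose] S by (simp add: matrix_transpose_mul matrix_mul_assoc)
  define e where "e = S ** X"
  define P where "P = transpose X ** S ** X"
  have e2: "e = transpose X ** S"
    unfolding e_def by (metis X Y matrix_mul_assoc)
  have eT: "transpose e = e"
    by (metis e2 e_def S matrix_transpose_mul)
  have Se: "S ** e = S" and eS: "e ** S = S"
    using X Y by (simp_all add: e_def e2 matrix_mul_assoc) (metis e2 e_def matrix_mul_assoc)+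
  have ee: "e ** e = e"
    by (metis Se e2 matrix_mul_assoc)
  have SP: "S ** P = e"
    by (metis P_def Se e2 e_def matrix_mul_assoc)
  have PS: "P ** S = e"
    by (metis P_def eS e2 e_def matrix_mul_assoc)
  have PSP: "P ** S ** P = P"
    by (metis PS P_def ee e2 matrix_mul_assoc)
  let ?mp = "\<lambda>Z. S ** Z ** S = S \<and> Z ** S ** Z = Z \<and>
     transpose (S ** Z) = S ** Z \<and> transpose (Z ** S) = Z ** S"
  have "?mp P" using SP PS PSP eS eT by simp
  then have "pinv S = P"
    unfolding pinv_def by (intro the_equality) (blast intro: moore_penrose_unique)+
  moreover have "transpose P = P"
    by (simp add: P_def matrix_transpose_mul S matrix_mul_assoc)
  ultimately show "transpose (pinv S) = pinv S" "pinv S ** S ** pinv S = pinv S"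
    using PSP by simp_all
qed

section \<open>Optimality and existence of solutions\<close>

abbreviation analysis_l1 :: "real^'p^'n \<Rightarrow> real^'n \<Rightarrow> real" where
  "analysis_l1 D x \<equiv> \<Sum>i\<in>UNIV. \<bar>(transpose D *v x) $ i\<bar>"

lemma objective_diff:
  "objective \<Phi> D lam y z - objective \<Phi> D lam y x =
     lam * (analysis_l1 D z - analysis_l1 D x) - (y - \<Phi> *v x) \<bullet> (\<Phi> *v z - \<Phi> *v x)
     + (norm (\<Phi> *v z - \<Phi> *v x))\<^sup>2 / 2"
  unfolding objective_def power2_norm_eq_inner
  by (simp add: algebra_simps inner_commute) (simp add: field_simps)

lemma analysis_l1_segment:
  assumes "0 \<le> t" "t \<le> 1"
  shows "analysis_l1 D (x + t *\<^sub>R (z - x)) \<le> analysis_l1 D x + t * (analysis_l1 D z - analysis_l1 D x)"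
proof -
  have *: "\<bar>a + t * (b - a)\<bar> \<le> \<bar>a\<bar> + t * (\<bar>b\<bar> - \<bar>a\<bar>)" for a b :: real
  proof -
    have "a + t * (b - a) = (1 - t) * a + t * b" by (simp add: algebra_simps)
    also have "\<bar>\<dots>\<bar> \<le> \<bar>(1 - t) * a\<bar> + \<bar>t * b\<bar>" by (rule abs_triangle_ineq)
    also have "\<dots> = \<bar>a\<bar> + t * (\<bar>b\<bar> - \<bar>a\<bar>)"
      using assms by (simp add: abs_mult) (simp add: algebra_simps)
    finally show ?thesis .
  qed
  have "analysis_l1 D (x + t *\<^sub>R (z - x))
     \<le> (\<Sum>i\<in>UNIV. \<bar>(transpose D *v x) $ i\<bar> + t * (\<bar>(transpose D *v z) $ i\<bar> - \<bar>(transpose D *v x) $ i\<bar>))"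
    by (intro sum_mono)
      (use * in \<open>simp add: matrix_vector_right_distrib matrix_vector_mult_diff_distrib matrix_vector_mult_scaleR\<close>)
  then show ?thesis by (simp add: sum.distrib sum_subtractf flip: sum_distrib_left)
qed

text \<open>The quadratic remainder in \<open>objective_diff\<close> is nonnegative, which gives sufficiency. For necessity,
  compare \<open>x\<close> with \<open>x + t (z - x)\<close>: convexity makes the \<open>l\<^sup>1\<close> part at most linear in \<open>t\<close>, the remainder
  is of order \<open>t\<^sup>2\<close>, and \<open>t\<close> tends to 0.\<close>

lemma is_solution_iff_variational:
  "is_solution \<Phi> D lam y x \<longleftrightarrow>
     (\<forall>z. (y - \<Phi> *v x) \<bullet> (\<Phi> *v z - \<Phi> *v x) \<le> lam * (analysis_l1 D z - analysis_l1 D x))"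
  if "lam \<ge> 0"
proof
  assume *: "\<forall>z. (y - \<Phi> *v x) \<bullet> (\<Phi> *v z - \<Phi> *v x) \<le> lam * (analysis_l1 D z - analysis_l1 D x)"
  show "is_solution \<Phi> D lam y x"
    unfolding is_solution_def
  proof
    fix z
    have "(y - \<Phi> *v x) \<bullet> (\<Phi> *v z - \<Phi> *v x) \<le> lam * (analysis_l1 D z - analysis_l1 D x)"
      using * by blast
    moreover have "0 \<le> (norm (\<Phi> *v z - \<Phi> *v x))\<^sup>2 / 2" by simp
    ultimately show "objective \<Phi> D lam y x \<le> objective \<Phi> D lam y z"
      using objective_diff[of \<Phi> D lam y z x] by linarith
  qed
next
  assume sol: "is_solution \<Phi> D lam y x"
  show "\<forall>z. (y - \<Phi> *v x) \<bullet> (\<Phi> *v z - \<Phi> *v x) \<le> lam * (analysis_l1 D z - analysis_l1 D x)"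
  proof
    fix z
    define d where "d = \<Phi> *v z - \<Phi> *v x"
    define R where "R = (y - \<Phi> *v x) \<bullet> d"
    define L where "L = lam * (analysis_l1 D z - analysis_l1 D x)"
    define c where "c = (norm d)\<^sup>2 / 2"
    have c: "c \<ge> 0" by (simp add: c_def)
    have step: "R \<le> L + t * c" if t: "0 < t" "t \<le> 1" for t
    proof -
      let ?x = "x + t *\<^sub>R (z - x)"
      have d': "\<Phi> *v ?x - \<Phi> *v x = t *\<^sub>R d"
        by (simp add: d_def matrix_vector_right_distrib matrix_vector_mult_diff_distrib matrix_vector_mult_scaleR)
      have n: "(norm (t *\<^sub>R d))\<^sup>2 / 2 = t * (t * c)"
        by (simp add: c_def power2_eq_square)
      have "0 \<le> objective \<Phi> D lam y ?x - objective \<Phi> D lam y x"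
        using sol by (simp add: is_solution_def)
      also have "\<dots> = lam * (analysis_l1 D ?x - analysis_l1 D x) - t * R + t * (t * c)"
        unfolding objective_diff d' n by (simp add: R_def)
      also have "\<dots> \<le> lam * (t * (analysis_l1 D z - analysis_l1 D x)) - t * R + t * (t * c)"
        using mult_left_mono[OF _ \<open>lam \<ge> 0\<close>, of "analysis_l1 D ?x - analysis_l1 D x"
            "t * (analysis_l1 D z - analysis_l1 D x)"] analysis_l1_segment[of t D x z] t by simp
      finally have "0 \<le> t * (L - R + t * c)" by (simp add: L_def algebra_simps)
      then have "0 \<le> L - R + t * c" using t by (simp add: zero_le_mult_iff)
      then show ?thesis by linarith
    qed
    have "R \<le> L"
    proof (rule field_le_epsilon)
      fix e :: real assume e: "e > 0"
      define t where "t = min 1 (e / (c + 1))"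
      have t: "0 < t" "t \<le> 1" using e c by (auto simp: t_def)
      have "t * c \<le> e / (c + 1) * (c + 1)"
        using c e t by (intro mult_mono) (auto simp: t_def)
      also have "\<dots> = e" using c by simp
      finally show "R \<le> L + e" using step[OF t] by linarith
    qed
    then show "(y - \<Phi> *v x) \<bullet> (\<Phi> *v z - \<Phi> *v x) \<le> lam * (analysis_l1 D z - analysis_l1 D x)"
      by (simp add: R_def L_def d_def)
  qed
qed

text \<open>Adding the variational inequalities of the two solutions, each tested against the other, cancels
  the \<open>l\<^sup>1\<close> terms and leaves \<open>\<parallel>d\<parallel>\<^sup>2 \<le> (y - y') \<bullet> d\<close> for the difference \<open>d\<close> of the images. For \<open>y = y'\<close>
  this is uniqueness of the image.\<close>

lemma solution_image_nonexpansive: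
  assumes lam: "lam \<ge> 0" and x: "is_solution \<Phi> D lam y x" and x': "is_solution \<Phi> D lam y' x'"
  shows "norm (\<Phi> *v x - \<Phi> *v x') \<le> norm (y - y')"
proof -
  let ?d = "\<Phi> *v x - \<Phi> *v x'"
  have "(y - \<Phi> *v x) \<bullet> (\<Phi> *v x' - \<Phi> *v x) \<le> lam * (analysis_l1 D x' - analysis_l1 D x)"
    "(y' - \<Phi> *v x') \<bullet> (\<Phi> *v x - \<Phi> *v x') \<le> lam * (analysis_l1 D x - analysis_l1 D x')"
    using x x' unfolding is_solution_iff_variational[OF lam] by blast+
  then have "?d \<bullet> ?d \<le> (y - y') \<bullet> ?d"
    by (simp add: algebra_simps inner_commute)
  also have "\<dots> \<le> norm (y - y') * norm ?d" by (rule norm_cauchy_schwarz)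
  finally have "norm ?d * norm ?d \<le> norm (y - y') * norm ?d"
    by (simp add: power2_norm_eq_inner flip: power2_eq_square)
  then show ?thesis
    by (cases "norm ?d = 0") (auto simp: mult_le_cancel_right)
qed

lemma mu_star_eq:
  assumes "lam \<ge> 0" and "is_solution \<Phi> D lam y x"
  shows "mu_star \<Phi> D lam y = \<Phi> *v x"
  unfolding mu_star_def
proof (rule the_equality)
  fix m assume "\<exists>x. is_solution \<Phi> D lam y x \<and> m = \<Phi> *v x"
  then show "m = \<Phi> *v x"
    using solution_image_nonexpansive[OF assms(1) _ assms(2)] by fastforce
qed (use assms in auto)

text \<open>The kernel condition makes \<open>z \<mapsto> \<parallel>\<Phi> z\<parallel> + \<parallel>D\<^sup>T z\<parallel>\<^sub>1\<close> a norm, bounded below by a multiple of the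
  Euclidean norm. The objective controls both summands, so its sublevel set at 0 is bounded.\<close>

lemma solution_exists:
  fixes \<Phi> :: "real^'n^'q" and D :: "real^'p^'n"
  assumes lam: "lam > 0" and ker: "matrix_ker \<Phi> \<inter> matrix_ker (transpose D) = {0}"
  shows "\<exists>x. is_solution \<Phi> D lam y x"
proof -
  define N where "N z = norm (\<Phi> *v z) + analysis_l1 D z" for z
  have l1_nonneg: "analysis_l1 D z \<ge> 0" for z by (intro sum_nonneg) auto
  have cont: "continuous_on S N" for S
    unfolding N_def by (intro continuous_intros matrix_vector_mult_linear_continuous_on)
  obtain u :: "real^'n" where u: "u \<in> sphere 0 1" "\<forall>z\<in>sphere 0 1. N u \<le> N z"
    using continuous_attains_inf[OF compact_sphere _ cont, of 0 1] by auto
  have "N u \<noteq> 0"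
  proof
    assume "N u = 0"
    then have "norm (\<Phi> *v u) = 0" "analysis_l1 D u = 0"
      using l1_nonneg[of u] norm_ge_zero[of "\<Phi> *v u"] unfolding N_def by linarith+
    then have "\<Phi> *v u = 0" "transpose D *v u = 0"
      by (auto simp: sum_nonneg_eq_0_iff vec_eq_iff)
    then have "u \<in> {0}" unfolding ker[symmetric] by (simp add: matrix_ker_def)
    then show False using u by simp
  qed
  then have Nu: "N u > 0" using l1_nonneg[of u] by (simp add: N_def add_nonneg_nonneg order.strict_iff_order)
  have coercive: "N u * norm z \<le> N z" for z
  proof (cases "z = 0")
    case False
    have "N ((1 / norm z) *\<^sub>R z) = (1 / norm z) * N z"
      by (simp add: N_def matrix_vector_mult_scaleR distrib_left sum_distrib_left abs_mult
          flip: sum_divide_distrib)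
    moreover have "N u \<le> N ((1 / norm z) *\<^sub>R z)" using u(2) False by simp
    ultimately have "N u \<le> (1 / norm z) * N z" by simp
    then show ?thesis using False by (simp add: field_simps)
  qed (simp add: N_def)
  define R where "R = (2 * norm y + (norm y)\<^sup>2 / 2 / lam) / N u"
  have R: "R \<ge> 0" using Nu lam by (simp add: R_def)
  have obj0: "objective \<Phi> D lam y 0 = (norm y)\<^sup>2 / 2" by (simp add: objective_def)
  have bound: "norm z \<le> R" if "objective \<Phi> D lam y z \<le> objective \<Phi> D lam y 0" for z
  proof -
    have *: "(norm (y - \<Phi> *v z))\<^sup>2 / 2 + lam * analysis_l1 D z \<le> (norm y)\<^sup>2 / 2"
      using that unfolding obj0 by (simp add: objective_def)
    have "lam * analysis_l1 D z \<ge> 0" using lam l1_nonneg by simp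
    then have "(norm (y - \<Phi> *v z))\<^sup>2 \<le> (norm y)\<^sup>2" using * by linarith
    then have "norm (y - \<Phi> *v z) \<le> norm y" by (simp add: power2_le_iff_abs_le)
    then have "norm (\<Phi> *v z) \<le> 2 * norm y"
      using norm_triangle_ineq2[of "\<Phi> *v z" y] by (simp add: norm_minus_commute)
    moreover have "lam * analysis_l1 D z \<le> (norm y)\<^sup>2 / 2" using * zero_le_power2[of "norm (y - \<Phi> *v z)"] by linarith
    then have "analysis_l1 D z \<le> (norm y)\<^sup>2 / 2 / lam" using lam by (simp add: field_simps)
    ultimately have "N u * norm z \<le> 2 * norm y + (norm y)\<^sup>2 / 2 / lam"
      using coercive[of z] unfolding N_def by linarith
    then show ?thesis using Nu by (simp add: R_def field_simps)
  qed
  have cont_obj: "continuous_on (cball 0 R) (objective \<Phi> D lam y)"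
    unfolding objective_def by (intro continuous_intros matrix_vector_mult_linear_continuous_on)
  then obtain x where x: "x \<in> cball 0 R" "\<forall>z\<in>cball 0 R. objective \<Phi> D lam y x \<le> objective \<Phi> D lam y z"
    using continuous_attains_inf[OF compact_cball _ cont_obj] R by auto
  have "objective \<Phi> D lam y x \<le> objective \<Phi> D lam y z" for z
  proof (cases "objective \<Phi> D lam y z \<le> objective \<Phi> D lam y 0")
    case True
    then show ?thesis using bound[OF True] x(2) by simp
  next
    case False
    moreover have "objective \<Phi> D lam y x \<le> objective \<Phi> D lam y 0" using x(2) R by simp
    ultimately show ?thesis by linarith
  qed
  then show ?thesis by (auto simp: is_solution_def)
qed

text \<open>Take a solution with a cosupport of maximal size. If \<open>h \<noteq> 0\<close> in its cospace were killed by \<open>\<Phi>\<close>,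
  then \<open>D\<^sup>T h \<noteq> 0\<close>, and moving along \<open>h\<close> until the first entry of \<open>D\<^sup>T x\<close> vanishes would keep optimality,
  since along this segment the \<open>l\<^sup>1\<close> norm is affine with a minimum inside. The cosupport
  would grow.\<close>

lemma solution_cond_H_exists:
  fixes \<Phi> :: "real^'n^'q" and D :: "real^'p^'n"
  assumes lam: "lam > 0" and ker: "matrix_ker \<Phi> \<inter> matrix_ker (transpose D) = {0}"
  shows "\<exists>x. is_solution \<Phi> D lam y x \<and> cond_H \<Phi> D (cosupport D x)"
proof -
  obtain x0 where "is_solution \<Phi> D lam y x0" using solution_exists[OF assms] by blast
  then obtain x where x: "is_solution \<Phi> D lam y x"
    and max: "\<And>z. is_solution \<Phi> D lam y z \<Longrightarrow> card (cosupport D z) \<le> card (cosupport D x)"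
    using ex_has_greatest_nat[of "is_solution \<Phi> D lam y" x0 "\<lambda>z. card (cosupport D z)" "Suc CARD('p)"]
    by (auto simp: less_Suc_eq_le card_mono)
  have "cond_H \<Phi> D (cosupport D x)"
  proof (rule ccontr)
    assume notH: "\<not> cond_H \<Phi> D (cosupport D x)"
    have "0 \<in> matrix_ker \<Phi> \<inter> cospace D (cosupport D x)"
      by (simp add: matrix_ker_def mem_cospace)
    then obtain h where h: "h \<noteq> 0" "\<Phi> *v h = 0" "h \<in> cospace D (cosupport D x)"
      using notH by (auto simp: cond_H_def matrix_ker_def)
    define a where "a = transpose D *v x"
    define b where "b = transpose D *v h"
    have cos: "cosupport D x = {i. a $ i = 0}" by (simp add: cosupport_def a_def)
    have b0: "b $ i = 0" if "a $ i = 0" for i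
      using h(3) that unfolding mem_cospace cos b_def by simp
    have "b \<noteq> 0"
    proof
      assume "b = 0"
      then have "h \<in> {0}" unfolding ker[symmetric] using h by (simp add: matrix_ker_def b_def)
      then show False using h by simp
    qed
    then have "{i. b $ i \<noteq> 0} \<noteq> {}" by (auto simp: vec_eq_iff)
    then obtain k where k: "b $ k \<noteq> 0" and kmin: "\<And>i. b $ i \<noteq> 0 \<Longrightarrow> \<bar>a $ k\<bar> / \<bar>b $ k\<bar> \<le> \<bar>a $ i\<bar> / \<bar>b $ i\<bar>"
      using ex_is_arg_min_if_finite[of "{i. b $ i \<noteq> 0}" "\<lambda>i. \<bar>a $ i\<bar> / \<bar>b $ i\<bar>"]
      by (auto simp: is_arg_min_linorder)
    \<comment> \<open>The parameter of smallest modulus at which an entry of \<open>D\<^sup>T (x + t h)\<close> off the cosupport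
      vanishes; up to \<open>\<plusminus> t\<close> no entry changes its sign.\<close>
    define t where "t = - (a $ k / b $ k)"
    have small: "\<bar>t * b $ i\<bar> \<le> \<bar>a $ i\<bar>" for i
    proof (cases "b $ i = 0")
      case False
      then show ?thesis using kmin[OF False] by (simp add: t_def abs_mult field_simps)
    qed simp
    have tr: "transpose D *v (x + r *\<^sub>R h) = a + r *\<^sub>R b" for r
      by (simp add: a_def b_def matrix_vector_right_distrib matrix_vector_mult_scaleR)
    have \<Phi>r: "\<Phi> *v (x + r *\<^sub>R h) = \<Phi> *v x" for r
      by (simp add: h matrix_vector_right_distrib matrix_vector_mult_scaleR)
    have ge: "analysis_l1 D x \<le> analysis_l1 D (x + r *\<^sub>R h)" for r
    proof -
      have "0 \<le> lam * (analysis_l1 D (x + r *\<^sub>R h) - analysis_l1 D x)"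
        using x unfolding is_solution_iff_variational[OF less_imp_le[OF lam]]
        by (metis \<Phi>r diff_self inner_zero_right)
      then show ?thesis using lam by (simp add: zero_le_mult_iff)
    qed
    have "analysis_l1 D (x + t *\<^sub>R h) + analysis_l1 D (x + (- t) *\<^sub>R h) = 2 * analysis_l1 D x"
      unfolding tr sum.distrib[symmetric] sum_distrib_left a_def[symmetric]
    proof (rule sum.cong)
      fix i
      show "\<bar>(a + t *\<^sub>R b) $ i\<bar> + \<bar>(a + (- t) *\<^sub>R b) $ i\<bar> = 2 * \<bar>a $ i\<bar>"
        using small[of i] by (simp add: abs_if split: if_splits)
    qed simp
    then have eq: "analysis_l1 D (x + t *\<^sub>R h) = analysis_l1 D x"
      using ge[of t] ge[of "- t"] by linarith
    have "objective \<Phi> D lam y (x + t *\<^sub>R h) = objective \<Phi> D lam y x"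
      unfolding objective_def \<Phi>r eq ..
    then have sol: "is_solution \<Phi> D lam y (x + t *\<^sub>R h)"
      using x by (simp add: is_solution_def)
    have "cosupport D x \<subseteq> cosupport D (x + t *\<^sub>R h)"
      unfolding cos by (auto simp: cosupport_def tr b0)
    moreover have "(transpose D *v (x + t *\<^sub>R h)) $ k = 0"
      using k unfolding tr by (simp add: t_def)
    then have "k \<in> cosupport D (x + t *\<^sub>R h)" "k \<notin> cosupport D x"
      using k b0 by (auto simp: cosupport_def a_def[symmetric])
    ultimately have "card (cosupport D x) < card (cosupport D (x + t *\<^sub>R h))"
      by (intro psubset_card_mono) auto
    then show False using max[OF sol] by simp
  qed
  then show ?thesis using x by blast
qed

section \<open>Multipliers and the local affine formula\<close>

text \<open>The hypotheses on \<open>v\<close> say that it is a subgradient of the \<open>l\<^sup>1\<close> norm at \<open>D\<^sup>T x\<close>; the equation then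
  turns the subgradient inequality into the variational inequality.\<close>

lemma solution_if_multiplier:
  fixes \<Phi> :: "real^'n^'q" and D :: "real^'p^'n"
  assumes lam: "lam \<ge> 0"
    and v: "\<And>i. \<bar>v $ i\<bar> \<le> 1" "\<And>i. v $ i * (transpose D *v x) $ i = \<bar>(transpose D *v x) $ i\<bar>"
    and eq: "transpose \<Phi> *v (y - \<Phi> *v x) = lam *\<^sub>R (D *v v)"
  shows "is_solution \<Phi> D lam y x"
  unfolding is_solution_iff_variational[OF lam]
proof
  fix z
  have "(y - \<Phi> *v x) \<bullet> (\<Phi> *v z - \<Phi> *v x) = (transpose \<Phi> *v (y - \<Phi> *v x)) \<bullet> (z - x)"
    by (subst inner_transpose_mult) (simp add: matrix_vector_mult_diff_distrib)
  also have "\<dots> = lam * (v \<bullet> (transpose D *v z) - v \<bullet> (transpose D *v x))"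
    unfolding eq by (simp add: right_diff_distrib inner_mult_transpose matrix_vector_mult_diff_distrib inner_diff_right)
  also have "v \<bullet> (transpose D *v x) = analysis_l1 D x"
    by (simp add: inner_vec_def v)
  also have "v \<bullet> (transpose D *v z) \<le> analysis_l1 D z"
    unfolding inner_vec_def
  proof (intro sum_mono)
    fix i
    have "v $ i * (transpose D *v z) $ i \<le> \<bar>v $ i\<bar> * \<bar>(transpose D *v z) $ i\<bar>"
      by (metis abs_ge_self abs_mult)
    also have "\<dots> \<le> 1 * \<bar>(transpose D *v z) $ i\<bar>" by (intro mult_right_mono v) auto
    finally show "v $ i \<bullet> (transpose D *v z) $ i \<le> \<bar>(transpose D *v z) $ i\<bar>" by simp
  qed
  then have "lam * (v \<bullet> (transpose D *v z) - analysis_l1 D x) \<le> lam * (analysis_l1 D z - analysis_l1 D x)"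
    using lam by (intro mult_left_mono) auto
  finally show "(y - \<Phi> *v x) \<bullet> (\<Phi> *v z - \<Phi> *v x) \<le> lam * (analysis_l1 D z - analysis_l1 D x)" .
qed

text \<open>The vectors \<open>D v\<close>, with \<open>v\<close> a subgradient of the \<open>l\<^sup>1\<close> norm at \<open>D\<^sup>T x\<close>, form a compact convex set
  \<open>C\<close>. If the rescaled residual \<open>p\<close> were not in \<open>C\<close>, a separating direction \<open>h\<close> would have
  \<open>h \<bullet> p\<close> larger than the support function of \<open>C\<close> at \<open>h\<close>. That support function is the directional
  derivative of \<open>\<parallel>D\<^sup>T x\<parallel>\<^sub>1\<close> along \<open>h\<close>, which contradicts the variational inequality for a small step.\<close>

lemma solution_multiplier:
  fixes \<Phi> :: "real^'n^'q" and D :: "real^'p^'n"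
  assumes lam: "lam > 0" and sol: "is_solution \<Phi> D lam y x"
  obtains v where "\<And>i. \<bar>v $ i\<bar> \<le> 1"
    "\<And>i. (transpose D *v x) $ i \<noteq> 0 \<Longrightarrow> v $ i = sgn ((transpose D *v x) $ i)"
    "transpose \<Phi> *v (y - \<Phi> *v x) = lam *\<^sub>R (D *v v)"
proof -
  define a where "a = transpose D *v x"
  define l :: "real^'p" where "l = (\<chi> i. if a $ i = 0 then -1 else sgn (a $ i))"
  define u :: "real^'p" where "u = (\<chi> i. if a $ i = 0 then 1 else sgn (a $ i))"
  define C where "C = (\<lambda>v. D *v v) ` cbox l u"
  define p where "p = (1 / lam) *\<^sub>R (transpose \<Phi> *v (y - \<Phi> *v x))"
  have "compact C" "convex C"
    unfolding C_def
    by (intro compact_continuous_image compact_cbox matrix_vector_mult_linear_continuous_on)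
      (intro convex_linear_image convex_box matrix_vector_mul_linear)
  have "p \<in> C"
  proof (rule ccontr)
    assume "p \<notin> C"
    then obtain c r where cr: "c \<bullet> p < r" "\<And>q. q \<in> C \<Longrightarrow> c \<bullet> q > r"
      using separating_hyperplane_closed_point[OF \<open>convex C\<close> compact_imp_closed[OF \<open>compact C\<close>]] by blast
    define h where "h = - c"
    define b where "b = transpose D *v h"
    \<comment> \<open>The subgradient that realises the directional derivative along \<open>h\<close>.\<close>
    define v :: "real^'p" where "v = (\<chi> i. if a $ i = 0 then sgn (b $ i) else sgn (a $ i))"
    have "v \<in> cbox l u"
      by (auto simp: mem_box_cart v_def l_def u_def sgn_if)
    then have 1: "h \<bullet> (D *v v) < h \<bullet> p"
      using cr(1) cr(2)[of "D *v v"] by (auto simp: C_def h_def)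
    have "\<forall>\<^sub>F t in at_right 0. a $ i \<noteq> 0 \<longrightarrow> t * \<bar>b $ i\<bar> \<le> \<bar>a $ i\<bar>" for i
    proof (cases "a $ i = 0")
      case False
      have "((\<lambda>t. t * \<bar>b $ i\<bar>) \<longlongrightarrow> 0 * \<bar>b $ i\<bar>) (at_right 0)"
        by (intro tendsto_intros)
      then have "\<forall>\<^sub>F t in at_right 0. t * \<bar>b $ i\<bar> < \<bar>a $ i\<bar>"
        using False by (intro order_tendstoD(2)) auto
      then show ?thesis by eventually_elim auto
    qed simp
    then have "\<forall>\<^sub>F t in at_right (0::real). \<forall>i. a $ i \<noteq> 0 \<longrightarrow> t * \<bar>b $ i\<bar> \<le> \<bar>a $ i\<bar>"
      by (rule eventually_all_finite)
    moreover have "\<forall>\<^sub>F t in at_right (0::real). 0 < t" by (rule eventually_at_right_less)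
    ultimately have "\<forall>\<^sub>F t in at_right (0::real). 0 < t \<and> (\<forall>i. a $ i \<noteq> 0 \<longrightarrow> t * \<bar>b $ i\<bar> \<le> \<bar>a $ i\<bar>)"
      by eventually_elim auto
    then obtain t where t: "t > 0" "\<And>i. a $ i \<noteq> 0 \<Longrightarrow> t * \<bar>b $ i\<bar> \<le> \<bar>a $ i\<bar>"
      using eventually_happens'[of "at_right (0::real)"] by auto
    have "analysis_l1 D (x + t *\<^sub>R h) = (\<Sum>i\<in>UNIV. \<bar>a $ i\<bar> + t * (v $ i * b $ i))"
    proof (rule sum.cong)
      fix i
      have "(transpose D *v (x + t *\<^sub>R h)) $ i = a $ i + t * b $ i"
        by (simp add: a_def b_def matrix_vector_right_distrib matrix_vector_mult_scaleR)
      moreover have "\<bar>a $ i + t * b $ i\<bar> = \<bar>a $ i\<bar> + t * (v $ i * b $ i)"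
      proof (cases "a $ i = 0")
        case True
        then show ?thesis using t(1) by (simp add: v_def abs_real_def sgn_if mult_less_0_iff)
      next
        case False
        have "\<bar>t * b $ i\<bar> \<le> \<bar>a $ i\<bar>" using t(1) t(2)[OF False] by (simp add: abs_mult)
        then show ?thesis using False by (simp add: v_def sgn_if abs_if split: if_splits)
      qed
      ultimately show "\<bar>(transpose D *v (x + t *\<^sub>R h)) $ i\<bar> = \<bar>a $ i\<bar> + t * (v $ i * b $ i)" by simp
    qed simp
    also have "\<dots> = analysis_l1 D x + t * (v \<bullet> b)"
      by (simp add: sum.distrib a_def inner_vec_def flip: sum_distrib_left)
    finally have l1: "analysis_l1 D (x + t *\<^sub>R h) - analysis_l1 D x = t * (v \<bullet> b)" by simp
    have "(y - \<Phi> *v x) \<bullet> (\<Phi> *v (x + t *\<^sub>R h) - \<Phi> *v x) \<le> lam * (t * (v \<bullet> b))"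
      using sol l1 unfolding is_solution_iff_variational[OF less_imp_le[OF lam]] by metis
    moreover have "(y - \<Phi> *v x) \<bullet> (\<Phi> *v (x + t *\<^sub>R h) - \<Phi> *v x) = t * lam * (h \<bullet> p)"
      using lam by (simp add: p_def matrix_vector_right_distrib matrix_vector_mult_scaleR inner_transpose_mult inner_commute[of h])
    moreover have "v \<bullet> b = h \<bullet> (D *v v)"
      by (simp add: b_def inner_mult_transpose inner_commute[of h])
    ultimately have "h \<bullet> p \<le> h \<bullet> (D *v v)" using t(1) lam by (simp add: mult.commute mult.left_commute)
    then show False using 1 by simp
  qed
  then obtain v where v: "v \<in> cbox l u" "p = D *v v" by (auto simp: C_def)
  have vi: "l $ i \<le> v $ i" "v $ i \<le> u $ i" for i using v(1) by (auto simp: mem_box_cart)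
  show ?thesis
  proof (rule that[of v])
    show "\<bar>v $ i\<bar> \<le> 1" for i
      using vi[of i] by (auto simp: l_def u_def sgn_if split: if_splits)
    show "v $ i = sgn ((transpose D *v x) $ i)" if "(transpose D *v x) $ i \<noteq> 0" for i
      using vi[of i] that by (simp add: l_def u_def a_def)
    show "transpose \<Phi> *v (y - \<Phi> *v x) = lam *\<^sub>R (D *v v)"
      using lam by (simp add: p_def flip: v(2))
  qed
qed

text \<open>Choosing preimages for the unit vectors only makes the choice linear, hence continuous. This
  supplies the correction of the multipliers below.\<close>

lemma matrix_factor_through:
  fixes A :: "real^'n^'m" and B :: "real^'k^'m"
  assumes "matrix_im A \<subseteq> matrix_im B"
  obtains T where "A = B ** T"
proof -
  have "\<exists>t. A *v axis j 1 = B *v t" for j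
    using assms by (auto simp: matrix_im_def)
  then obtain t where t: "\<And>j. A *v axis j 1 = B *v t j" by metis
  define T :: "real^'n^'k" where "T = (\<chi> i j. t j $ i)"
  have "T *v axis j 1 = t j" for j
    by (simp add: T_def matrix_vector_mult_basis column_def vec_eq_iff)
  then have "column j A = column j (B ** T)" for j
    by (metis matrix_vector_mult_basis matrix_vector_mul_assoc t)
  then have "A = B ** T" by (simp add: vec_eq_iff column_def)
  then show ?thesis using that by blast
qed

lemma trans_slice_mem_iff:
  assumes "lam \<ge> 0"
  shows "y \<in> trans_slice \<Phi> D lam \<longleftrightarrow>
     (\<exists>J K s t. cond_H \<Phi> D J \<and> K \<subseteq> J \<and> \<not> matrix_im (Pi_tilde \<Phi> D J) \<subseteq> matrix_im (cols D (J - K)) \<and>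
        s \<in> sign_vectors (-J) \<and> t \<in> sign_vectors K \<and>
        (\<forall>g\<in>cospace D (J - K). (Pi_tilde \<Phi> D J *v y -
            lam *\<^sub>R (Omega_tilde \<Phi> D J *v s - cols D K *v t)) \<bullet> g = 0))"
  using assms
  by (simp add: trans_slice_def trans_space_def trans_piece_def orth_proj_eq_scaleR_iff subspace_cospace)
    blast

lemma tendsto_matrix_vector_mult:
  fixes A :: "real^'n^'m"
  assumes "(f \<longlongrightarrow> l) F"
  shows "((\<lambda>x. A *v f x) \<longlongrightarrow> A *v l) F"
  by (rule bounded_linear.tendsto[OF matrix_vector_mul_bounded_linear assms])

text \<open>\<open>X y'\<close> is the affine candidate for the solution at \<open>y'\<close> and \<open>V y'\<close> its multiplier: the change of the
  residual is \<open>- Pi_tilde \<Phi> D J *v (y' - y)\<close>, which outside the slice factors through the columns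
  of \<open>D\<close> in \<open>J - K\<close>, so only multiplier entries with \<open>\<bar>v\<^sub>i\<bar> < 1\<close> have to move. Being a multiplier
  then reduces to strict inequalities, which persist near \<open>y\<close>.\<close>

lemma mu_star_locally_affine:
  fixes \<Phi> :: "real^'n^'q" and D :: "real^'p^'n"
  assumes lam: "lam > 0" and y: "y \<notin> trans_slice \<Phi> D lam"
    and sol: "is_solution \<Phi> D lam y x" and H: "cond_H \<Phi> D (cosupport D x)"
  obtains c where "\<forall>\<^sub>F y' in nhds y.
    mu_star \<Phi> D lam y' = (\<Phi> ** A_op \<Phi> D (cosupport D x) ** transpose \<Phi>) *v y' + c"
proof -
  define J where "J = cosupport D x"
  define A where "A = A_op \<Phi> D J"
  define a where "a = transpose D *v x"
  have HJ: "cond_H \<Phi> D J" using H by (simp add: J_def)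
  have J: "i \<in> J \<longleftrightarrow> a $ i = 0" for i by (simp add: J_def cosupport_def a_def)
  obtain v where v1: "\<And>i. \<bar>v $ i\<bar> \<le> 1" and v2: "\<And>i. a $ i \<noteq> 0 \<Longrightarrow> v $ i = sgn (a $ i)"
    and v3: "transpose \<Phi> *v (y - \<Phi> *v x) = lam *\<^sub>R (D *v v)"
    using solution_multiplier[OF lam sol] unfolding a_def by blast
  define K where "K = {i\<in>J. \<bar>v $ i\<bar> = 1}"
  define s :: "real^'p" where "s = (\<chi> i. if i \<in> J then 0 else v $ i)"
  define t :: "real^'p" where "t = (\<chi> i. if i \<in> K then v $ i else 0)"
  have s: "s \<in> sign_vectors (-J)"
    by (auto simp: sign_vectors_def s_def J v2 sgn_if)
  have t: "t \<in> sign_vectors K"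
    by (auto simp: sign_vectors_def t_def K_def abs_if split: if_splits)
  have colsJ: "cols D (-J) *v s = D *v s"
    unfolding cols_mult by (rule arg_cong[of _ _ "(*v) D"]) (simp add: vec_eq_iff s_def)
  have split: "D *v v = D *v s + cols D K *v t + cols D (J - K) *v v"
    unfolding cols_mult matrix_vector_right_distrib[symmetric]
    by (rule arg_cong[of _ _ "(*v) D"]) (auto simp: vec_eq_iff s_def t_def K_def)
  have xG: "x \<in> cospace D J" by (simp add: mem_cospace J a_def)
  \<comment> \<open>On the cospace, the part of \<open>D v\<close> coming from \<open>J\<close> is invisible.\<close>
  have x_eq: "x = A *v (transpose \<Phi> *v y - lam *\<^sub>R (D *v s))"
    unfolding A_def
  proof (rule A_op_unique[OF HJ xG])
    fix g assume g: "g \<in> cospace D J"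
    have "(D *v v) \<bullet> g = (D *v s) \<bullet> g"
      unfolding inner_mult_transpose unfolding inner_vec_def
      by (rule sum.cong) (use g in \<open>auto simp: s_def mem_cospace\<close>)
    then have "(transpose \<Phi> *v (y - \<Phi> *v x)) \<bullet> g = lam * ((D *v s) \<bullet> g)"
      by (simp add: v3)
    then show "(\<Phi> *v x) \<bullet> (\<Phi> *v g) = (transpose \<Phi> *v y - lam *\<^sub>R (D *v s)) \<bullet> g"
      by (simp add: inner_transpose_mult inner_diff_left)
  qed
  have Pi: "Pi_tilde \<Phi> D J *v z = transpose \<Phi> *v (\<Phi> *v (A *v (transpose \<Phi> *v z))) - transpose \<Phi> *v z" for z
    by (simp add: Pi_tilde_def A_def matrix_vector_mult_diff_distrib matrix_vector_mult_diff_rdistrib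
        flip: matrix_vector_mul_assoc)
  have Om: "Omega_tilde \<Phi> D J *v s = transpose \<Phi> *v (\<Phi> *v (A *v (D *v s))) - D *v s"
    by (simp add: Omega_tilde_def A_def colsJ matrix_vector_mult_diff_rdistrib flip: matrix_vector_mul_assoc)
  have "transpose \<Phi> *v (\<Phi> *v x) - transpose \<Phi> *v y + lam *\<^sub>R (D *v s)
      = Pi_tilde \<Phi> D J *v y - lam *\<^sub>R (Omega_tilde \<Phi> D J *v s)"
    unfolding Pi Om by (subst x_eq)
      (simp add: matrix_vector_mult_diff_distrib matrix_vector_mult_scaleR scaleR_diff_right)
  then have "Pi_tilde \<Phi> D J *v y - lam *\<^sub>R (Omega_tilde \<Phi> D J *v s - cols D K *v t)
      = - lam *\<^sub>R (cols D (J - K) *v v)"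
    using v3 split by (simp add: matrix_vector_mult_diff_distrib algebra_simps)
  then have "\<forall>g\<in>cospace D (J - K). (Pi_tilde \<Phi> D J *v y -
            lam *\<^sub>R (Omega_tilde \<Phi> D J *v s - cols D K *v t)) \<bullet> g = 0"
    by (simp add: inner_cols_cospace)
  \<comment> \<open>Otherwise the equation just proved would put \<open>y\<close> into the slice.\<close>
  then have "matrix_im (Pi_tilde \<Phi> D J) \<subseteq> matrix_im (cols D (J - K))"
    using y HJ s t lam unfolding trans_slice_mem_iff[OF less_imp_le[OF lam]]
    by (metis (no_types, lifting) K_def mem_Collect_eq subsetI)
  then obtain T where T: "Pi_tilde \<Phi> D J = cols D (J - K) ** T"
    by (rule matrix_factor_through)
  define X where "X y' = A *v (transpose \<Phi> *v y' - lam *\<^sub>R (D *v s))" for y'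
  define V where "V y' = (\<chi> i. if i \<in> J - K then v $ i - (1 / lam) * (T *v (y' - y)) $ i else v $ i)" for y'
  have Xy: "X y = x" by (simp add: X_def flip: x_eq)
  have Vy: "V y = v" by (simp add: V_def vec_eq_iff)
  have eq: "transpose \<Phi> *v (y' - \<Phi> *v X y') = lam *\<^sub>R (D *v V y')" for y'
  proof -
    have "transpose \<Phi> *v (y' - \<Phi> *v X y') = transpose \<Phi> *v (y - \<Phi> *v X y) - Pi_tilde \<Phi> D J *v (y' - y)"
      unfolding Pi X_def by (simp add: matrix_vector_mult_diff_distrib)
    also have "\<dots> = lam *\<^sub>R (D *v v) - lam *\<^sub>R (cols D (J - K) *v ((1 / lam) *\<^sub>R (T *v (y' - y))))"
      using lam by (simp add: Xy v3 T matrix_vector_mult_scaleR flip: matrix_vector_mul_assoc)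
    also have "\<dots> = lam *\<^sub>R (D *v V y')"
      unfolding cols_mult scaleR_diff_right[symmetric] matrix_vector_mult_diff_distrib[symmetric]
      by (rule arg_cong[of _ _ "\<lambda>z. lam *\<^sub>R (D *v z)"]) (auto simp: vec_eq_iff V_def)
    finally show ?thesis .
  qed
  have XJ: "(transpose D *v X y') $ i = 0" if "i \<in> J" for y' i
    using A_op_in_cospace[OF HJ] that unfolding X_def A_def mem_cospace by blast
  have contV: "((\<lambda>y'. V y' $ i) \<longlongrightarrow> V y $ i) (nhds y)" for i
  proof (cases "i \<in> J - K")
    case True
    have "((\<lambda>y'. v $ i - (1 / lam) * (T *v (y' - y)) $ i) \<longlongrightarrow> v $ i - (1 / lam) * (T *v (y - y)) $ i) (nhds y)"
      by (intro tendsto_intros tendsto_matrix_vector_mult filterlim_ident)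
    then show ?thesis using True by (simp add: V_def)
  next
    case False
    then have "V y' $ i = v $ i" for y' by (auto simp: V_def)
    then show ?thesis by simp
  qed
  have contX: "((\<lambda>y'. (transpose D *v X y') $ i) \<longlongrightarrow> a $ i) (nhds y)" for i
  proof -
    have "((\<lambda>y'. (transpose D *v X y') $ i) \<longlongrightarrow> (transpose D *v X y) $ i) (nhds y)"
      unfolding X_def by (intro tendsto_intros tendsto_matrix_vector_mult filterlim_ident)
    then show ?thesis by (simp add: Xy a_def)
  qed
  have ev1: "\<forall>\<^sub>F y' in nhds y. \<bar>V y' $ i\<bar> \<le> 1" for i
  proof (cases "i \<in> J - K")
    case True
    then have "\<bar>V y $ i\<bar> < 1" using v1[of i] by (auto simp: Vy K_def)
    then have "\<forall>\<^sub>F y' in nhds y. \<bar>V y' $ i\<bar> < 1"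
      by (intro order_tendstoD(2)[OF tendsto_rabs[OF contV]])
    then show ?thesis by eventually_elim auto
  next
    case False
    then have "\<bar>V y' $ i\<bar> \<le> 1" for y' using v1 by (auto simp: V_def)
    then show ?thesis by simp
  qed
  have ev2: "\<forall>\<^sub>F y' in nhds y. V y' $ i * (transpose D *v X y') $ i = \<bar>(transpose D *v X y') $ i\<bar>" for i
  proof (cases "i \<in> J")
    case True
    then show ?thesis by (simp add: XJ)
  next
    case False
    then have ai: "a $ i \<noteq> 0" by (simp add: J)
    have V: "V y' $ i = sgn (a $ i)" for y' using False v2[OF ai] by (simp add: V_def)
    show ?thesis
    proof (cases "a $ i > 0")
      case True
      then have "\<forall>\<^sub>F y' in nhds y. (transpose D *v X y') $ i > 0"
        by (intro order_tendstoD(1)[OF contX])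
      then show ?thesis by eventually_elim (use True V in auto)
    next
      case neg: False
      then have "\<forall>\<^sub>F y' in nhds y. (transpose D *v X y') $ i < 0"
        using ai by (intro order_tendstoD(2)[OF contX]) auto
      then show ?thesis by eventually_elim (use neg ai V in auto)
    qed
  qed
  have "\<forall>\<^sub>F y' in nhds y. \<forall>i. \<bar>V y' $ i\<bar> \<le> 1"
    "\<forall>\<^sub>F y' in nhds y. \<forall>i. V y' $ i * (transpose D *v X y') $ i = \<bar>(transpose D *v X y') $ i\<bar>"
    using ev1 ev2 by (simp_all add: eventually_all_finite)
  then have "\<forall>\<^sub>F y' in nhds y. mu_star \<Phi> D lam y' =
      (\<Phi> ** A_op \<Phi> D (cosupport D x) ** transpose \<Phi>) *v y' + (- lam *\<^sub>R (\<Phi> *v (A *v (D *v s))))"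
  proof eventually_elim
    case (elim y')
    have "is_solution \<Phi> D lam y' (X y')"
      by (rule solution_if_multiplier[of lam "V y'"]) (use elim eq lam in auto)
    then have "mu_star \<Phi> D lam y' = \<Phi> *v X y'" by (rule mu_star_eq[OF less_imp_le[OF lam]])
    then show ?case
      by (simp add: X_def A_def J_def matrix_vector_mult_diff_distrib matrix_vector_mult_scaleR
          flip: matrix_vector_mul_assoc)
  qed
  then show ?thesis by (rule that)
qed

section \<open>The transition slice is a closed null set\<close>

lemma finite_sign_vectors: "finite (sign_vectors J :: (real^'p) set)"
proof (rule finite_subset)
  show "sign_vectors J \<subseteq> (\<lambda>f. \<chi> i. f i) ` (PiE (UNIV :: 'p set) (\<lambda>_. {-1, 0, 1}))"
  proof
    fix s :: "real^'p" assume "s \<in> sign_vectors J"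
    then have "($) s \<in> PiE UNIV (\<lambda>_. {-1, 0, 1})"
      by (auto simp: sign_vectors_def PiE_def)
    moreover have "s = (\<chi> i. s $ i)" by simp
    ultimately show "s \<in> (\<lambda>f. \<chi> i. f i) ` (PiE UNIV (\<lambda>_. {-1, 0, 1}))" by blast
  qed
qed (simp add: finite_PiE)

text \<open>Each piece is an intersection of solution sets of scalar affine equations, hence closed, and
  finitely many pieces occur. The range condition on \<open>Pi_tilde\<close> provides one \<open>g\<close> for which the affine
  equation is nontrivial, so that the piece lies in a hyperplane.\<close>

lemma
  fixes \<Phi> :: "real^'n^'q" and D :: "real^'p^'n"
  assumes lam: "lam \<ge> 0"
  shows closed_trans_slice: "closed (trans_slice \<Phi> D lam)"
    and negligible_trans_slice: "negligible (trans_slice \<Phi> D lam)"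
proof -
  define P where "P J K s t = {y. \<forall>g\<in>cospace D (J - K). (Pi_tilde \<Phi> D J *v y -
            lam *\<^sub>R (Omega_tilde \<Phi> D J *v s - cols D K *v t)) \<bullet> g = 0}" for J K s t
  define Z where "Z = {(J, K). \<not> matrix_im (Pi_tilde \<Phi> D J) \<subseteq> matrix_im (cols D (J - K))
     \<and> cond_H \<Phi> D J \<and> K \<subseteq> J}"
  have eq: "trans_slice \<Phi> D lam =
     (\<Union>(J, K)\<in>Z. \<Union>s\<in>sign_vectors (-J). \<Union>t\<in>sign_vectors K. P J K s t)"
    unfolding set_eq_iff trans_slice_mem_iff[OF lam] P_def Z_def by (simp; blast)
  have cl: "closed (P J K s t)" for J K s t
  proof -
    have "P J K s t = (\<Inter>g\<in>cospace D (J - K). {y. (Pi_tilde \<Phi> D J *v y -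
            lam *\<^sub>R (Omega_tilde \<Phi> D J *v s - cols D K *v t)) \<bullet> g = 0})"
      by (auto simp: P_def)
    also have "closed \<dots>"
      by (intro closed_INT ballI closed_Collect_eq continuous_intros matrix_vector_mult_linear_continuous_on)
    finally show ?thesis .
  qed
  have neg: "negligible (P J K s t)"
    if ni: "\<not> matrix_im (Pi_tilde \<Phi> D J) \<subseteq> matrix_im (cols D (J - K))" for J K s t
  proof -
    obtain z where "Pi_tilde \<Phi> D J *v z \<notin> matrix_im (cols D (J - K))"
      using ni unfolding matrix_im_def by blast
    then obtain g where g: "g \<in> cospace D (J - K)" "(Pi_tilde \<Phi> D J *v z) \<bullet> g \<noteq> 0"
      unfolding mem_range_cols_iff by blast
    have "transpose (Pi_tilde \<Phi> D J) *v g \<noteq> 0"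
      using g(2) unfolding inner_mult_transpose by force
    then have "negligible {y. (transpose (Pi_tilde \<Phi> D J) *v g) \<bullet> y =
        lam * ((Omega_tilde \<Phi> D J *v s - cols D K *v t) \<bullet> g)}"
      by (intro negligible_hyperplane) simp
    then show ?thesis
    proof (rule negligible_subset)
      show "P J K s t \<subseteq> {y. (transpose (Pi_tilde \<Phi> D J) *v g) \<bullet> y =
        lam * ((Omega_tilde \<Phi> D J *v s - cols D K *v t) \<bullet> g)}"
        using g(1) by (auto simp: P_def inner_transpose_mult inner_diff_left inner_commute[of g] algebra_simps)
    qed
  qed
  have fin: "finite Z" by simp
  show "closed (trans_slice \<Phi> D lam)"
    unfolding eq
    by (intro closed_UN fin ballI) (auto intro!: closed_UN finite_sign_vectors cl)
  show "negligible (trans_slice \<Phi> D lam)"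
    unfolding eq
    by (intro negligible_Union finite_imageI fin)
      (auto intro!: negligible_Union finite_sign_vectors neg simp: Z_def)
qed

section \<open>Integration by parts for Lipschitz maps\<close>

lemma
  fixes f :: "'a::euclidean_space \<Rightarrow> real"
  assumes f: "f \<in> borel_measurable borel"
  shows lborel_integrable_translate: "integrable lborel (\<lambda>x. f (c + x)) \<longleftrightarrow> integrable lborel f"
    and lborel_integral_translate: "(\<integral>x. f (c + x) \<partial>lborel) = (\<integral>x. f x \<partial>lborel)"
proof -
  have "integrable (distr lborel borel ((+) c)) f = integrable lborel (\<lambda>x. f (c + x))"
    by (subst integrable_distr_eq) (use f in \<open>auto\<close>)
  then show "integrable lborel (\<lambda>x. f (c + x)) \<longleftrightarrow> integrable lborel f"
    unfolding lborel_distr_plus by simp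
  have "integral\<^sup>L (distr lborel borel ((+) c)) f = (\<integral>x. f (c + x) \<partial>lborel)"
    by (subst integral_distr) (use f in \<open>auto\<close>)
  then show "(\<integral>x. f (c + x) \<partial>lborel) = (\<integral>x. f x \<partial>lborel)"
    unfolding lborel_distr_plus by simp
qed

lemma directional_difference_bound:
  fixes \<phi> :: "'a::real_normed_vector \<Rightarrow> real"
  assumes der: "\<And>x. ((\<lambda>s. \<phi> (x + s *\<^sub>R e)) has_real_derivative \<phi>' x) (at 0)"
    and bd: "\<And>s. \<bar>s\<bar> \<le> 1 \<Longrightarrow> \<bar>\<phi>' (x + s *\<^sub>R e)\<bar> \<le> B" and t: "\<bar>t\<bar> \<le> 1"
  shows "\<bar>\<phi> (x + t *\<^sub>R e) - \<phi> x\<bar> \<le> B * \<bar>t\<bar>"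
proof -
  have D: "((\<lambda>r. \<phi> (x + r *\<^sub>R e)) has_real_derivative \<phi>' (x + s *\<^sub>R e)) (at s within S)" for s S
  proof -
    have "((\<lambda>r. \<phi> (x + (r + s) *\<^sub>R e)) has_real_derivative \<phi>' (x + s *\<^sub>R e)) (at 0)"
      using der[of "x + s *\<^sub>R e"] by (simp add: scaleR_add_left add_ac)
    then have "((\<lambda>r. \<phi> (x + r *\<^sub>R e)) has_real_derivative \<phi>' (x + s *\<^sub>R e)) (at (0 + s))"
      unfolding DERIV_shift .
    then show ?thesis by (simp add: has_field_derivative_at_within)
  qed
  have "norm (\<phi> (x + t *\<^sub>R e) - \<phi> (x + 0 *\<^sub>R e)) \<le> B * norm (t - 0)"
    by (rule field_differentiable_bound[OF _ D, where S = "{-1..1}"])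
      (use t bd in \<open>auto simp: abs_le_iff\<close>)
  then show ?thesis by simp
qed

text \<open>By translation invariance of Lebesgue measure,
  \<open>\<integral> (f (x + h e) - f x) / h * \<phi> x = - \<integral> f x * (\<phi> (x - h e) - \<phi> x) / (- h)\<close>. For \<open>h\<close> tending to 0 the
  left side is dominated because \<open>f\<close> is Lipschitz along \<open>e\<close>, and the right side because of the bound
  \<open>\<psi>\<close>. The integrand on the left has to converge almost everywhere only. The domination is stated
  for the product of \<open>f\<close> with the derivative of \<open>\<phi>\<close>, a form that fits both test functions, which
  vanish far away, and Gaussian densities, which outweigh the growth of \<open>f\<close>.\<close>

lemma integration_by_parts_direction:
  fixes f \<phi> G \<phi>' \<psi> :: "'a::euclidean_space \<Rightarrow> real" and e :: 'a
  assumes f: "continuous_on UNIV f" and lip: "\<And>x t. \<bar>f (x + t *\<^sub>R e) - f x\<bar> \<le> L * \<bar>t\<bar>"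
    and G: "G \<in> borel_measurable borel"
    and f_der: "AE x in lborel. ((\<lambda>s. f (x + s *\<^sub>R e)) has_real_derivative G x) (at 0)"
    and \<phi>: "continuous_on UNIV \<phi>" "integrable lborel \<phi>"
    and \<phi>_der: "\<And>x. ((\<lambda>s. \<phi> (x + s *\<^sub>R e)) has_real_derivative \<phi>' x) (at 0)"
    and dom: "\<And>x s. \<bar>s\<bar> \<le> 1 \<Longrightarrow> \<bar>f x\<bar> * \<bar>\<phi>' (x + s *\<^sub>R e)\<bar> \<le> \<psi> x"
    and \<psi>: "integrable lborel \<psi>"
    and f\<phi>: "integrable lborel (\<lambda>x. f x * \<phi> x)"
  shows "integrable lborel (\<lambda>x. G x * \<phi> x)"
    and "integrable lborel (\<lambda>x. f x * \<phi>' x)"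
    and "(\<integral>x. G x * \<phi> x \<partial>lborel) = - (\<integral>x. f x * \<phi>' x \<partial>lborel)"
proof -
  define h :: "nat \<Rightarrow> real" where "h n = inverse (real (Suc n))" for n
  have h: "0 < h n" "h n \<le> 1" for n by (simp_all add: h_def field_simps)
  have h0: "h \<longlonglongrightarrow> 0" unfolding h_def by (rule LIMSEQ_inverse_real_of_nat)
  have hlim: "filterlim h (at 0) sequentially" "filterlim (\<lambda>n. - h n) (at 0) sequentially"
    using h0 tendsto_minus[OF h0] h by (auto simp: filterlim_at less_imp_neq[symmetric])
  have fm[measurable]: "f \<in> borel_measurable borel" and \<phi>m[measurable]: "\<phi> \<in> borel_measurable borel"
    using f \<phi> by (auto intro: borel_measurable_continuous_onI)
  note G[measurable]
  define u where "u n x = (f (x + h n *\<^sub>R e) - f x) / h n * \<phi> x" for n x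
  define r where "r n x = f x * ((\<phi> (x + (- h n) *\<^sub>R e) - \<phi> x) / (- h n))" for n x
  have um[measurable]: "u n \<in> borel_measurable borel" and rm[measurable]: "r n \<in> borel_measurable borel" for n
    unfolding u_def r_def by measurable
  have u_lim: "AE x in lborel. (\<lambda>n. u n x) \<longlonglongrightarrow> G x * \<phi> x"
    using f_der
  proof eventually_elim
    case (elim x)
    then have "((\<lambda>s. (f (x + s *\<^sub>R e) - f x) / s) \<longlongrightarrow> G x) (at 0)"
      by (simp add: DERIV_def)
    from filterlim_compose[OF this hlim(1)] show ?case
      unfolding u_def by (intro tendsto_mult tendsto_const)
  qed
  have r_lim: "(\<lambda>n. r n x) \<longlonglongrightarrow> f x * \<phi>' x" for x
  proof -
    have "((\<lambda>s. (\<phi> (x + s *\<^sub>R e) - \<phi> x) / s) \<longlongrightarrow> \<phi>' x) (at 0)"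
      using \<phi>_der[of x] by (simp add: DERIV_def)
    from filterlim_compose[OF this hlim(2)] show ?thesis
      unfolding r_def by (intro tendsto_mult tendsto_const)
  qed
  have u_bd: "norm (u n x) \<le> L * \<bar>\<phi> x\<bar>" for n x
  proof -
    have "\<bar>f (x + h n *\<^sub>R e) - f x\<bar> / h n \<le> L"
      using lip[of x "h n"] h[of n] by (simp add: field_simps)
    then have "\<bar>f (x + h n *\<^sub>R e) - f x\<bar> / h n * \<bar>\<phi> x\<bar> \<le> L * \<bar>\<phi> x\<bar>"
      by (rule mult_right_mono) simp
    then show ?thesis using h[of n] by (simp add: u_def abs_mult)
  qed
  have \<phi>_diff: "\<bar>f x\<bar> * \<bar>\<phi> (x + t *\<^sub>R e) - \<phi> x\<bar> \<le> \<psi> x * \<bar>t\<bar>" if t: "\<bar>t\<bar> \<le> 1" for x t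
  proof (cases "f x = 0")
    case True
    have "0 \<le> \<psi> x" using dom[of 0 x] True by simp
    then show ?thesis using True by simp
  next
    case False
    have "\<bar>\<phi> (x + t *\<^sub>R e) - \<phi> x\<bar> \<le> \<psi> x / \<bar>f x\<bar> * \<bar>t\<bar>"
    proof (rule directional_difference_bound[OF \<phi>_der _ t])
      fix s :: real assume "\<bar>s\<bar> \<le> 1"
      then show "\<bar>\<phi>' (x + s *\<^sub>R e)\<bar> \<le> \<psi> x / \<bar>f x\<bar>"
        using dom[of s x] False by (simp add: field_simps)
    qed
    then show ?thesis using False by (simp add: field_simps)
  qed
  have r_bd: "norm (r n x) \<le> \<psi> x" for n x
  proof -
    have "norm (r n x) = \<bar>f x\<bar> * \<bar>\<phi> (x + (- h n) *\<^sub>R e) - \<phi> x\<bar> / h n"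
      using h[of n] by (simp add: r_def abs_mult)
    then show ?thesis
      using \<phi>_diff[of "- h n" x] h[of n] by (simp add: pos_divide_le_eq)
  qed
  have \<phi>'m: "(\<lambda>x. f x * \<phi>' x) \<in> borel_measurable borel"
    by (rule borel_measurable_LIMSEQ_real[OF r_lim rm])
  have L\<phi>: "integrable lborel (\<lambda>x. L * \<bar>\<phi> x\<bar>)" using \<phi>(2) by simp
  show "integrable lborel (\<lambda>x. G x * \<phi> x)"
    by (rule integrable_dominated_convergence[OF _ _ L\<phi> u_lim]) (use u_bd in auto)
  have ulim: "(\<lambda>n. \<integral>x. u n x \<partial>lborel) \<longlonglongrightarrow> (\<integral>x. G x * \<phi> x \<partial>lborel)"
    by (rule integral_dominated_convergence[OF _ _ L\<phi> u_lim]) (use u_bd in auto)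
  show "integrable lborel (\<lambda>x. f x * \<phi>' x)"
    by (rule integrable_dominated_convergence[OF _ _ \<psi>, where s = r]) (use r_bd r_lim \<phi>'m in auto)
  have rlim: "(\<lambda>n. \<integral>x. r n x \<partial>lborel) \<longlonglongrightarrow> (\<integral>x. f x * \<phi>' x \<partial>lborel)"
    by (rule integral_dominated_convergence[OF _ _ \<psi>, where s = r]) (use r_bd r_lim \<phi>'m in auto)
  have "(\<integral>x. u n x \<partial>lborel) = - (\<integral>x. r n x \<partial>lborel)" for n
  proof -
    let ?c = "h n *\<^sub>R e"
    define k where "k x = f x * \<phi> (x - ?c)" for x
    have km[measurable]: "k \<in> borel_measurable borel" unfolding k_def by measurable
    have r_int: "integrable lborel (r n)"
      by (rule Bochner_Integration.integrable_bound[OF \<psi>]) (use r_bd[of n] in \<open>auto intro!: AE_I2 intro: order_trans[OF _ abs_ge_self]\<close>)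
    have k_eq: "k x = f x * \<phi> x - h n * r n x" for x
      using h[of n] by (simp add: k_def r_def field_simps)
    have k_int: "integrable lborel k" unfolding k_eq[abs_def]
      using f\<phi> r_int by auto
    have k_tr: "k (?c + x) = f (x + ?c) * \<phi> x" for x by (simp add: k_def add.commute)
    have int1: "integrable lborel (\<lambda>x. f (x + ?c) * \<phi> x)"
      using lborel_integrable_translate[OF km, of ?c] k_int by (simp add: k_tr)
    have "(\<integral>x. u n x \<partial>lborel) = (\<integral>x. (f (x + ?c) * \<phi> x - f x * \<phi> x) / h n \<partial>lborel)"
      by (simp add: u_def left_diff_distrib diff_divide_distrib)
    also have "\<dots> = ((\<integral>x. k (?c + x) \<partial>lborel) - (\<integral>x. f x * \<phi> x \<partial>lborel)) / h n"
      using int1 f\<phi> by (simp add: k_tr)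
    also have "\<dots> = ((\<integral>x. k x \<partial>lborel) - (\<integral>x. f x * \<phi> x \<partial>lborel)) / h n"
      by (simp add: lborel_integral_translate[OF km])
    also have "(\<integral>x. k x \<partial>lborel) = (\<integral>x. f x * \<phi> x \<partial>lborel) - h n * (\<integral>x. r n x \<partial>lborel)"
      unfolding k_eq[abs_def] using f\<phi> r_int by simp
    finally show ?thesis using h[of n] by simp
  qed
  then have "(\<lambda>n. - (\<integral>x. r n x \<partial>lborel)) \<longlonglongrightarrow> (\<integral>x. G x * \<phi> x \<partial>lborel)"
    using ulim by simp
  from LIMSEQ_unique[OF this tendsto_minus[OF rlim]]
  show "(\<integral>x. G x * \<phi> x \<partial>lborel) = - (\<integral>x. f x * \<phi>' x \<partial>lborel)" .
qed

lemma jacobian_entry_derivative: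
  fixes f :: "real^'q \<Rightarrow> real^'m"
  assumes "f differentiable (at x)"
  shows "((\<lambda>s. f (x + s *\<^sub>R axis j 1) $ i) has_real_derivative jacobian f (at x) $ i $ j) (at 0)"
proof -
  have f: "(f has_derivative (\<lambda>h. jacobian f (at x) *v h)) (at (x + 0 *\<^sub>R axis j 1))"
    using assms by (simp add: jacobian_works)
  have "((\<lambda>s. x + s *\<^sub>R axis j 1) has_derivative (\<lambda>s. s *\<^sub>R axis j 1)) (at (0::real))"
    by (auto intro!: derivative_eq_intros)
  from has_derivative_compose[OF this f]
  have "((\<lambda>s. f (x + s *\<^sub>R axis j 1) $ i) has_derivative
      (\<lambda>s. (jacobian f (at x) *v (s *\<^sub>R axis j 1)) $ i)) (at 0)"
    by (rule bounded_linear.has_derivative[OF bounded_linear_vec_nth])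
  moreover have "(\<lambda>s. (jacobian f (at x) *v (s *\<^sub>R axis j 1)) $ i) = (*) (jacobian f (at x) $ i $ j)"
    by (simp add: fun_eq_iff matrix_vector_mult_scaleR matrix_vector_mult_basis column_def)
  ultimately show ?thesis by (simp add: has_field_derivative_def)
qed

lemma directional_derivative_le_Lipschitz:
  fixes f :: "'a::real_normed_vector \<Rightarrow> real"
  assumes lip: "\<And>t. \<bar>f (x + t *\<^sub>R e) - f x\<bar> \<le> L * \<bar>t\<bar>"
    and der: "((\<lambda>s. f (x + s *\<^sub>R e)) has_real_derivative d) (at 0)"
  shows "\<bar>d\<bar> \<le> L"
proof (rule tendsto_upperbound)
  show "((\<lambda>s. \<bar>(f (x + s *\<^sub>R e) - f x) / s\<bar>) \<longlongrightarrow> \<bar>d\<bar>) (at 0)"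
    using der by (intro tendsto_rabs) (simp add: DERIV_def)
  have "\<bar>(f (x + s *\<^sub>R e) - f x) / s\<bar> \<le> L" if "s \<noteq> 0" for s
    using lip[of s] that by (simp add: field_simps)
  then show "\<forall>\<^sub>F s in at 0. \<bar>(f (x + s *\<^sub>R e) - f x) / s\<bar> \<le> L"
    by (auto simp: eventually_at_filter)
qed simp

lemma lebesgue_measurable_AE_eq:
  fixes f g :: "'a::euclidean_space \<Rightarrow> real"
  assumes g: "g \<in> borel_measurable lebesgue" and ae: "AE x in lebesgue. f x = g x"
  shows "f \<in> borel_measurable lebesgue"
proof (rule measurableI)
  fix A :: "real set" assume A: "A \<in> sets borel"
  show "f -` A \<inter> space lebesgue \<in> sets lebesgue"
  proof (rule completion.in_sets_AE)
    show "AE x in lebesgue. (x \<in> g -` A \<inter> space lebesgue) = (x \<in> f -` A \<inter> space lebesgue)"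
      using ae by eventually_elim auto
    show "g -` A \<inter> space lebesgue \<in> sets lebesgue"
      using g A by (rule measurable_sets)
  qed auto
qed auto

text \<open>The jacobian takes unspecified values on \<open>N\<close>, so it is only Lebesgue measurable. The proof works
  with the Borel representative \<open>G\<close>, which vanishes on \<open>N\<close>.\<close>

lemma has_weak_jacobian_Lipschitz:
  fixes f :: "real^'q \<Rightarrow> real^'m"
  assumes lip: "\<And>x y. norm (f x - f y) \<le> L * norm (x - y)"
    and N: "closed N" "negligible N"
    and diff: "\<And>x. x \<notin> N \<Longrightarrow> f differentiable (at x)"
    and cont: "continuous_on (-N) (\<lambda>x. jacobian f (at x))"
  shows "has_weak_jacobian f (\<lambda>x. jacobian f (at x))"
proof -
  have f_cont: "continuous_on UNIV f"
    by (rule lipschitz_on_continuous_on[of "\<bar>L\<bar>"])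
      (auto simp: lipschitz_on_def dist_norm intro: order_trans[OF lip mult_right_mono])
  then have fi_cont: "continuous_on S (\<lambda>x. f x $ i)" for i S
    by (intro continuous_intros) (auto intro: continuous_on_subset)
  have fi_lip: "\<bar>f (x + t *\<^sub>R axis j 1) $ i - f x $ i\<bar> \<le> L * \<bar>t\<bar>" for x t i j
  proof -
    have "\<bar>(f (x + t *\<^sub>R axis j 1) - f x) $ i\<bar> \<le> norm (f (x + t *\<^sub>R axis j 1) - f x)"
      by (rule component_le_norm_cart)
    also have "\<dots> \<le> L * \<bar>t\<bar>" using lip[of "x + t *\<^sub>R axis j 1" x] by simp
    finally show ?thesis by simp
  qed
  have ae: "AE x in lebesgue. x \<notin> N"
    using N by (intro AE_not_in) (simp add: negligible_iff_null_sets)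
  then have ae': "AE x in lborel. x \<notin> N" by (simp add: AE_completion_iff)
  define G where "G i j x = (if x \<in> N then 0 else jacobian f (at x) $ i $ j)" for i j x
  have Gm[measurable]: "G i j \<in> borel_measurable borel" for i j
    unfolding G_def using N(1)
    by (intro borel_measurable_continuous_on_if continuous_intros cont) auto
  have G_ae: "AE x in lebesgue. jacobian f (at x) $ i $ j = G i j x" for i j
    using ae by eventually_elim (simp add: G_def)
  have Gm': "G i j \<in> borel_measurable lebesgue" for i j
    using Gm[of i j] by (intro measurable_completion) simp
  have Jm: "(\<lambda>x. jacobian f (at x) $ i $ j) \<in> borel_measurable lebesgue" for i j
    by (rule lebesgue_measurable_AE_eq[OF Gm' G_ae])
  have G_bd: "\<bar>G i j x\<bar> \<le> \<bar>L\<bar>" for i j x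
  proof (cases "x \<in> N")
    case False
    have "\<bar>jacobian f (at x) $ i $ j\<bar> \<le> L"
      by (rule directional_derivative_le_Lipschitz[OF fi_lip jacobian_entry_derivative[OF diff[OF False]]])
    then show ?thesis using False by (simp add: G_def)
  qed (simp add: G_def)
  have loc1: "locally_integrable (\<lambda>x. f x $ i)" for i
    unfolding locally_integrable_def
  proof (intro allI impI)
    fix C :: "(real^'q) set" assume "compact C"
    then have "integrable lborel (\<lambda>x. indicator C x *\<^sub>R (f x $ i))"
      by (intro borel_integrable_compact fi_cont)
    then show "(\<lambda>x. f x $ i) absolutely_integrable_on C"
      unfolding set_integrable_def
      by (subst integrable_completion) (auto dest: borel_measurable_integrable)
  qed
  have loc2: "locally_integrable (\<lambda>x. jacobian f (at x) $ i $ j)" for i j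
    unfolding locally_integrable_def
  proof (intro allI impI)
    fix C :: "(real^'q) set" assume C: "compact C"
    have C': "C \<in> sets borel" using C by (simp add: borel_compact)
    then have C'': "C \<in> sets lebesgue" by simp
    have "integrable lborel (\<lambda>x. indicator C x *\<^sub>R \<bar>L\<bar>)"
      by (intro borel_integrable_compact C continuous_intros)
    then have *: "integrable lebesgue (\<lambda>x. indicator C x *\<^sub>R \<bar>L\<bar>)"
      by (subst integrable_completion) (auto dest: borel_measurable_integrable)
    show "(\<lambda>x. jacobian f (at x) $ i $ j) absolutely_integrable_on C"
      unfolding set_integrable_def
    proof (rule Bochner_Integration.integrable_bound[OF *])
      show "(\<lambda>x. indicat_real C x *\<^sub>R jacobian f (at x) $ i $ j) \<in> borel_measurable lebesgue"
        using Jm C'' by (intro borel_measurable_scaleR borel_measurable_indicator)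
      show "AE x in lebesgue. norm (indicat_real C x *\<^sub>R jacobian f (at x) $ i $ j) \<le> norm (indicat_real C x *\<^sub>R \<bar>L\<bar>)"
        using G_ae[of i j] by eventually_elim (use G_bd[of i j] in \<open>auto simp: indicator_def\<close>)
    qed
  qed
  have parts: "(LINT x|lebesgue. f x $ i * g x $ j) = - (LINT x|lebesgue. jacobian f (at x) $ i $ j * \<phi> x)"
    if test: "test_function \<phi> g" for i j \<phi> g
  proof -
    have gd: "GDERIV \<phi> x :> g x" for x
      using test by (simp add: test_function_def)
    have gc: "continuous_on UNIV g"
      using test by (simp add: test_function_def)
    obtain C where C: "compact C" "\<And>x. x \<notin> C \<Longrightarrow> \<phi> x = 0"
      using test by (auto simp: test_function_def)
    obtain R where R: "C \<subseteq> ball 0 R" "R > 0"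
      using compact_imp_bounded[OF C(1)] bounded_subset_ballD by blast
    have \<phi>c: "continuous_on S \<phi>" for S
      using gd by (intro has_derivative_continuous_on) (auto simp: gderiv_def intro: has_derivative_at_withinI)
    let ?K = "cball 0 R :: (real^'q) set"
    have \<phi>0: "\<phi> x = 0" if "x \<notin> ?K" for x
      using C(2) R(1) that by (meson ball_subset_cball subsetD)
    have \<phi>_der: "((\<lambda>s. \<phi> (x + s *\<^sub>R axis j 1)) has_real_derivative g x $ j) (at 0)" for x
    proof -
      have f: "(\<phi> has_derivative (\<lambda>h. h \<bullet> g x)) (at (x + 0 *\<^sub>R axis j 1))"
        using gd[of x] by (simp add: gderiv_def)
      have "((\<lambda>s. x + s *\<^sub>R axis j 1) has_derivative (\<lambda>s. s *\<^sub>R axis j 1)) (at (0::real))"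
        by (auto intro!: derivative_eq_intros)
      from has_derivative_compose[OF this f]
      have "((\<lambda>s. \<phi> (x + s *\<^sub>R axis j 1)) has_derivative (\<lambda>s. (s *\<^sub>R axis j 1) \<bullet> g x)) (at 0)" .
      moreover have "(\<lambda>s. (s *\<^sub>R axis j 1) \<bullet> g x) = (*) (g x $ j)"
        by (simp add: fun_eq_iff inner_axis')
      ultimately show ?thesis by (simp add: has_field_derivative_def)
    qed
    have g0: "g x $ j = 0" if "x \<notin> ?K" for x
    proof (rule DERIV_unique[OF \<phi>_der])
      have "((\<lambda>s. x + s *\<^sub>R axis j 1) \<longlongrightarrow> x + 0 *\<^sub>R axis j 1) (nhds (0::real))"
        by (intro tendsto_intros filterlim_ident)
      then have "\<forall>\<^sub>F s in nhds (0::real). x + s *\<^sub>R axis j 1 \<in> - ?K"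
        using that by (intro topological_tendstoD) (auto simp: open_Compl)
      then have "\<forall>\<^sub>F s in nhds (0::real). \<phi> (x + s *\<^sub>R axis j 1) = 0"
        by eventually_elim (use \<phi>0 in auto)
      then show "((\<lambda>s. \<phi> (x + s *\<^sub>R axis j 1)) has_real_derivative 0) (at 0)"
        by (subst DERIV_cong_ev[OF refl _ refl]) auto
    qed
    have "compact ((\<lambda>x. g x $ j) ` ?K)"
      by (intro compact_continuous_image continuous_intros continuous_on_subset[OF gc]) auto
    then obtain B where B: "\<And>x. x \<in> ?K \<Longrightarrow> \<bar>g x $ j\<bar> \<le> B"
      using compact_imp_bounded bounded_iff by (metis imageI real_norm_def)
    have B0: "\<bar>g x $ j\<bar> \<le> \<bar>B\<bar>" for x
      using B[of x] g0[of x] by (cases "x \<in> ?K") auto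
    let ?K1 = "cball 0 (R + 1) :: (real^'q) set"
    define \<psi> where "\<psi> x = indicator ?K1 x *\<^sub>R (\<bar>f x $ i\<bar> * \<bar>B\<bar>)" for x
    have \<psi>: "integrable lborel \<psi>"
      unfolding \<psi>_def by (intro borel_integrable_compact compact_cball continuous_intros fi_cont)
    have \<phi>_int: "integrable lborel \<phi>"
    proof -
      have "integrable lborel (\<lambda>x. indicator ?K x *\<^sub>R \<phi> x)"
        by (intro borel_integrable_compact compact_cball \<phi>c)
      also have "(\<lambda>x. indicator ?K x *\<^sub>R \<phi> x) = \<phi>" using \<phi>0 by (auto simp: fun_eq_iff indicator_def)
      finally show ?thesis .
    qed
    have f\<phi>_int: "integrable lborel (\<lambda>x. f x $ i * \<phi> x)"
    proof -
      have "integrable lborel (\<lambda>x. indicator ?K x *\<^sub>R (f x $ i * \<phi> x))"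
        by (intro borel_integrable_compact compact_cball continuous_intros \<phi>c fi_cont)
      also have "(\<lambda>x. indicator ?K x *\<^sub>R (f x $ i * \<phi> x)) = (\<lambda>x. f x $ i * \<phi> x)"
        using \<phi>0 by (auto simp: fun_eq_iff indicator_def)
      finally show ?thesis .
    qed
    have dom: "\<bar>f x $ i\<bar> * \<bar>g (x + s *\<^sub>R axis j 1) $ j\<bar> \<le> \<psi> x" if s: "\<bar>s\<bar> \<le> 1" for x s
    proof (cases "x \<in> ?K1")
      case True
      then show ?thesis by (auto simp: \<psi>_def intro: mult_left_mono B0)
    next
      case False
      have "norm x \<le> norm (x + s *\<^sub>R axis j 1) + norm (s *\<^sub>R axis j 1 :: real^'q)"
        using norm_triangle_ineq4[of "x + s *\<^sub>R axis j 1" "s *\<^sub>R axis j 1"] by simp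
      then have "x + s *\<^sub>R axis j 1 \<notin> ?K" using False s by (auto simp: not_le)
      then show ?thesis using g0 by (simp add: \<psi>_def)
    qed
    have f_der: "AE x in lborel. ((\<lambda>s. f (x + s *\<^sub>R axis j 1) $ i) has_real_derivative G i j x) (at 0)"
      using ae'
    proof eventually_elim
      case (elim x)
      then show ?case using jacobian_entry_derivative[OF diff[OF elim], of j i] by (simp add: G_def)
    qed
    note ibp = integration_by_parts_direction[OF fi_cont fi_lip Gm f_der \<phi>c \<phi>_int \<phi>_der dom \<psi> f\<phi>_int]
    have \<phi>m: "\<phi> \<in> borel_measurable lborel" using \<phi>_int by (rule borel_measurable_integrable)
    have "(LINT x|lebesgue. jacobian f (at x) $ i $ j * \<phi> x) = (LINT x|lebesgue. G i j x * \<phi> x)"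
    proof (rule integral_cong_AE)
      have \<phi>m': "\<phi> \<in> borel_measurable lebesgue" using \<phi>m by (rule measurable_completion)
      show "(\<lambda>x. jacobian f (at x) $ i $ j * \<phi> x) \<in> borel_measurable lebesgue"
        "(\<lambda>x. G i j x * \<phi> x) \<in> borel_measurable lebesgue"
        using \<phi>m' Jm Gm' by (auto intro: borel_measurable_times)
      show "AE x in lebesgue. jacobian f (at x) $ i $ j * \<phi> x = G i j x * \<phi> x"
        using G_ae[of i j] by eventually_elim simp
    qed
    also have "\<dots> = (LINT x|lborel. G i j x * \<phi> x)"
      using borel_measurable_integrable[OF ibp(1)] by (rule integral_completion)
    also have "\<dots> = - (LINT x|lborel. f x $ i * g x $ j)" by (rule ibp(3))
    also have "(LINT x|lborel. f x $ i * g x $ j) = (LINT x|lebesgue. f x $ i * g x $ j)"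
      using borel_measurable_integrable[OF ibp(2)] by (rule integral_completion[symmetric])
    finally show ?thesis by simp
  qed
  show ?thesis unfolding has_weak_jacobian_def using loc1 loc2 parts by blast
qed

section \<open>Gaussian densities and Stein's identity\<close>

text \<open>The density of \<open>white_noise\<close>.\<close>

definition gaussian_density :: "real \<Rightarrow> real^'q \<Rightarrow> real" where
  "gaussian_density \<sigma> v = (\<Prod>i\<in>UNIV. normal_density 0 \<sigma> (v $ i))"

lemma gaussian_density_eq:
  fixes v :: "real^'q"
  shows "gaussian_density \<sigma> v =
    (1 / sqrt (2 * pi * \<sigma>\<^sup>2)) ^ CARD('q) * exp (- (norm v)\<^sup>2 / (2 * \<sigma>\<^sup>2))"
proof -
  have "(norm v)\<^sup>2 = (\<Sum>i\<in>UNIV. (v $ i)\<^sup>2)"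
    unfolding power2_norm_eq_inner by (simp add: inner_vec_def power2_eq_square)
  then have "exp (- (norm v)\<^sup>2 / (2 * \<sigma>\<^sup>2)) = (\<Prod>i\<in>UNIV. exp (- (v $ i)\<^sup>2 / (2 * \<sigma>\<^sup>2)))"
    by (simp add: sum_negf sum_divide_distrib flip: exp_sum)
  then show ?thesis by (simp add: gaussian_density_def normal_density_def prod_dividef power_one_over)
qed

lemma gaussian_density_nonneg: "0 \<le> gaussian_density \<sigma> v"
  by (simp add: gaussian_density_def prod_nonneg)

lemma continuous_on_gaussian_density: "continuous_on S (gaussian_density \<sigma>)"
  unfolding gaussian_density_eq[abs_def] by (cases "\<sigma> = 0") (auto intro!: continuous_intros)

lemma integrable_exp_neg_norm_square:
  fixes b :: real
  assumes b: "b > 0"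
  shows "integrable lborel (\<lambda>x::'a::euclidean_space. exp (- b * (norm x)\<^sup>2))"
proof (rule integrableI_nonneg)
  define s where "s = sqrt (1 / (2 * b))"
  have s: "s > 0" "s\<^sup>2 = 1 / (2 * b)" using b by (simp_all add: s_def)
  have "integrable lborel (normal_density 0 s)" by (rule integrable_normal_density[OF s(1)])
  then have "integrable lborel (\<lambda>x. sqrt (2 * pi * s\<^sup>2) * normal_density 0 s x)" by simp
  also have "(\<lambda>x. sqrt (2 * pi * s\<^sup>2) * normal_density 0 s x) = (\<lambda>x. exp (- b * x\<^sup>2))"
    using s b by (auto simp: fun_eq_iff normal_density_def)
  finally have int: "integrable lborel (\<lambda>x. exp (- b * x\<^sup>2))" .
  have fin: "(\<integral>\<^sup>+x. ennreal (exp (- b * x\<^sup>2)) \<partial>lborel) < \<infinity>"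
    using int by (subst nn_integral_eq_integral) auto
  have eq: "ennreal (exp (- b * (norm x)\<^sup>2)) = (\<Prod>i\<in>Basis. ennreal (exp (- b * (x \<bullet> i)\<^sup>2)))" for x :: 'a
  proof -
    have "(norm x)\<^sup>2 = (\<Sum>i\<in>Basis. (x \<bullet> i)\<^sup>2)"
      unfolding power2_norm_eq_inner by (subst euclidean_inner) (simp add: power2_eq_square)
    then have "exp (- b * (norm x)\<^sup>2) = (\<Prod>i\<in>Basis. exp (- b * (x \<bullet> i)\<^sup>2))"
      by (simp add: sum_negf sum_distrib_left flip: exp_sum)
    then show ?thesis by (simp add: prod_ennreal)
  qed
  have "(\<integral>\<^sup>+x. ennreal (exp (- b * (norm (x::'a))\<^sup>2)) \<partial>lborel)
      = (\<Prod>i\<in>(Basis::'a set). \<integral>\<^sup>+x. ennreal (exp (- b * x\<^sup>2)) \<partial>lborel)"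
    unfolding eq by (rule nn_integral_lborel_prod) auto
  also have "\<dots> < \<infinity>"
    using fin by (simp add: power_less_top_ennreal)
  finally show "(\<integral>\<^sup>+x. ennreal (exp (- b * (norm (x::'a))\<^sup>2)) \<partial>lborel) < \<infinity>" .
qed auto

text \<open>The polynomial factor costs half of the exponent, as \<open>u \<le> exp u\<close>.\<close>

lemma integrable_square_exp_neg_norm_square:
  fixes a :: real
  assumes a: "a > 0"
  shows "integrable lborel (\<lambda>x::'a::euclidean_space. (1 + norm x)\<^sup>2 * exp (- a * (norm x)\<^sup>2))"
proof (rule Bochner_Integration.integrable_bound)
  show "integrable lborel (\<lambda>x::'a. (2 + 4 / a) * exp (- (a / 2) * (norm x)\<^sup>2))"
    using a by (intro integrable_mult_right integrable_exp_neg_norm_square) simp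
  have "(1 + t)\<^sup>2 * exp (- a * t\<^sup>2) \<le> (2 + 4 / a) * exp (- (a / 2) * t\<^sup>2)" for t :: real
  proof -
    let ?E = "exp ((a / 2) * t\<^sup>2)"
    have "1 + (a / 2) * t\<^sup>2 \<le> ?E" by (rule exp_ge_add_one_self)
    moreover have "0 \<le> (a / 2) * t\<^sup>2" using a by simp
    ultimately have "(a / 2) * t\<^sup>2 \<le> ?E" "1 \<le> ?E" by linarith+
    then have "2 / a * ((a / 2) * t\<^sup>2) \<le> 2 / a * ?E" using a by (intro mult_left_mono) auto
    then have "t\<^sup>2 \<le> 2 / a * ?E" using a by simp
    have "(1 + t)\<^sup>2 \<le> 2 + 2 * t\<^sup>2"
      using zero_le_power2[of "1 - t"] by (simp add: power2_eq_square algebra_simps)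
    also have "\<dots> \<le> 2 * ?E + 2 * (2 / a * ?E)"
      using \<open>1 \<le> ?E\<close> \<open>t\<^sup>2 \<le> 2 / a * ?E\<close> by linarith
    also have "\<dots> = (2 + 4 / a) * ?E" by (simp add: algebra_simps)
    finally have "(1 + t)\<^sup>2 * exp (- a * t\<^sup>2) \<le> (2 + 4 / a) * ?E * exp (- a * t\<^sup>2)"
      by (rule mult_right_mono) simp
    also have "\<dots> = (2 + 4 / a) * exp (- (a / 2) * t\<^sup>2)"
      by (simp add: algebra_simps flip: exp_add)
    finally show ?thesis .
  qed
  then show "AE x::'a in lborel. norm ((1 + norm x)\<^sup>2 * exp (- a * (norm x)\<^sup>2))
      \<le> norm ((2 + 4 / a) * exp (- (a / 2) * (norm x)\<^sup>2))"
    using a by (intro AE_I2) (simp add: abs_mult)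
qed auto

lemma integrable_gaussian_quadratic_growth:
  fixes g :: "real^'q \<Rightarrow> real"
  assumes \<sigma>: "\<sigma> > 0" and g: "g \<in> borel_measurable borel" and bd: "\<And>v. \<bar>g v\<bar> \<le> C * (1 + norm v)\<^sup>2"
  shows "integrable lborel (\<lambda>v. gaussian_density \<sigma> v * g v)"
proof (rule Bochner_Integration.integrable_bound)
  let ?c = "(1 / sqrt (2 * pi * \<sigma>\<^sup>2)) ^ CARD('q)"
  show "integrable lborel (\<lambda>v::real^'q. ?c * C * ((1 + norm v)\<^sup>2 * exp (- (1 / (2 * \<sigma>\<^sup>2)) * (norm v)\<^sup>2)))"
    using \<sigma> by (intro integrable_mult_right integrable_square_exp_neg_norm_square) simp
  show "(\<lambda>v. gaussian_density \<sigma> v * g v) \<in> borel_measurable lborel"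
    using borel_measurable_times[OF borel_measurable_continuous_onI[OF continuous_on_gaussian_density[of UNIV \<sigma>]] g]
    by simp
  have "norm (gaussian_density \<sigma> v * g v) \<le> ?c * C * ((1 + norm v)\<^sup>2 * exp (- (1 / (2 * \<sigma>\<^sup>2)) * (norm v)\<^sup>2))" for v
  proof -
    have "norm (gaussian_density \<sigma> v * g v) \<le> gaussian_density \<sigma> v * (C * (1 + norm v)\<^sup>2)"
      using bd[of v] by (simp add: abs_mult gaussian_density_nonneg mult_left_mono)
    also have "\<dots> = ?c * C * ((1 + norm v)\<^sup>2 * exp (- (1 / (2 * \<sigma>\<^sup>2)) * (norm v)\<^sup>2))"
      by (simp add: gaussian_density_eq)
    finally show ?thesis .
  qed
  note b = this
  show "AE v in lborel. norm (gaussian_density \<sigma> v * g v)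
      \<le> norm (?c * C * ((1 + norm v)\<^sup>2 * exp (- (1 / (2 * \<sigma>\<^sup>2)) * (norm v)\<^sup>2)))"
    by (intro AE_I2) (rule order_trans[OF b], simp only: real_norm_def abs_ge_self)
qed

lemma gaussian_density_derivative:
  fixes x :: "real^'q"
  assumes \<sigma>: "\<sigma> > 0"
  shows "((\<lambda>s. gaussian_density \<sigma> (x + s *\<^sub>R axis j 1)) has_real_derivative
    - (x $ j / \<sigma>\<^sup>2) * gaussian_density \<sigma> x) (at 0)"
proof -
  have n: "(norm (x + s *\<^sub>R axis j 1))\<^sup>2 = (norm x)\<^sup>2 + 2 * s * x $ j + s\<^sup>2" for s
    unfolding power2_norm_eq_inner
    by (simp add: inner_add_left inner_add_right inner_axis inner_axis' power2_eq_square algebra_simps)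
  show ?thesis
    unfolding gaussian_density_eq n
    by (rule derivative_eq_intros refl | use \<sigma> in \<open>simp add: field_simps power2_eq_square\<close>)+
qed

text \<open>A locally uniform bound under translation: \<open>\<parallel>x\<parallel>\<^sup>2 \<le> 2 \<parallel>w\<parallel>\<^sup>2 + 2\<close> for \<open>w\<close> at distance at most 1 from
  \<open>x\<close>, so doubling the variance absorbs the shift.\<close>

lemma gaussian_density_translate_le:
  fixes x :: "real^'q"
  assumes \<sigma>: "\<sigma> > 0" and s: "\<bar>s\<bar> \<le> 1"
  shows "gaussian_density \<sigma> (x + s *\<^sub>R axis j 1) \<le>
    (1 / sqrt (2 * pi * \<sigma>\<^sup>2)) ^ CARD('q) * exp (1 / (2 * \<sigma>\<^sup>2)) * exp (- (1 / (4 * \<sigma>\<^sup>2)) * (norm x)\<^sup>2)"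
proof -
  let ?w = "x + s *\<^sub>R axis j 1 :: real^'q"
  have "norm x \<le> norm ?w + 1"
    using norm_triangle_ineq4[of ?w "s *\<^sub>R axis j 1"] s by simp
  then have "(norm x)\<^sup>2 \<le> (norm ?w + 1)\<^sup>2" by (intro power_mono) auto
  also have "\<dots> \<le> 2 * (norm ?w)\<^sup>2 + 2"
    using zero_le_power2[of "norm ?w - 1"] by (simp add: power2_eq_square algebra_simps)
  finally have "- (norm ?w)\<^sup>2 \<le> 1 - (norm x)\<^sup>2 / 2" by simp
  then have "- (norm ?w)\<^sup>2 / (2 * \<sigma>\<^sup>2) \<le> (1 - (norm x)\<^sup>2 / 2) / (2 * \<sigma>\<^sup>2)"
    by (rule divide_right_mono) simp
  also have "\<dots> = 1 / (2 * \<sigma>\<^sup>2) + - (1 / (4 * \<sigma>\<^sup>2)) * (norm x)\<^sup>2"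
    using \<sigma> by (simp add: field_simps)
  finally have "exp (- (norm ?w)\<^sup>2 / (2 * \<sigma>\<^sup>2)) \<le> exp (1 / (2 * \<sigma>\<^sup>2)) * exp (- (1 / (4 * \<sigma>\<^sup>2)) * (norm x)\<^sup>2)"
    by (simp flip: exp_add)
  then show ?thesis
    unfolding gaussian_density_eq by (simp only: mult.assoc) (intro mult_left_mono; simp)
qed

text \<open>Integration by parts against the Gaussian density \<open>p\<close>, with \<open>\<partial>\<^sub>j p = - (v\<^sub>j / \<sigma>\<^sup>2) p\<close>. The linear
  growth of \<open>f\<close> and of the factor \<open>v\<^sub>j\<close> is absorbed by a Gaussian of larger variance.\<close>

lemma stein_identity:
  fixes f G :: "real^'q \<Rightarrow> real"
  assumes \<sigma>: "\<sigma> > 0" and lip: "\<And>x y. \<bar>f x - f y\<bar> \<le> L * norm (x - y)" and L: "L \<ge> 0"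
    and G: "G \<in> borel_measurable borel"
    and f_der: "AE x in lborel. ((\<lambda>s. f (x + s *\<^sub>R axis j 1)) has_real_derivative G x) (at 0)"
  shows "integrable lborel (\<lambda>v. gaussian_density \<sigma> v * G v)"
    and "(\<integral>v. gaussian_density \<sigma> v * G v \<partial>lborel) = (\<integral>v. gaussian_density \<sigma> v * (f v * v $ j) \<partial>lborel) / \<sigma>\<^sup>2"
proof -
  let ?p = "gaussian_density \<sigma> :: real^'q \<Rightarrow> real"
  let ?c = "(1 / sqrt (2 * pi * \<sigma>\<^sup>2)) ^ CARD('q) * exp (1 / (2 * \<sigma>\<^sup>2))"
  define C where "C = \<bar>f 0\<bar> + L"
  have C: "\<bar>f x\<bar> \<le> C * (1 + norm x)" for x
  proof -
    have "\<bar>f x\<bar> \<le> \<bar>f 0\<bar> + L * norm x" using lip[of x 0] by simp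
    also have "\<dots> \<le> C * (1 + norm x)" using L by (simp add: C_def algebra_simps)
    finally show ?thesis .
  qed
  have C0: "C \<ge> 0" using L by (simp add: C_def)
  have f_cont: "continuous_on UNIV f"
    by (rule lipschitz_on_continuous_on[of L]) (use lip L in \<open>auto simp: lipschitz_on_def dist_norm\<close>)
  have fm: "f \<in> borel_measurable borel" using f_cont by (rule borel_measurable_continuous_onI)
  have lip': "\<bar>f (x + t *\<^sub>R axis j 1) - f x\<bar> \<le> L * \<bar>t\<bar>" for x t
    using lip[of "x + t *\<^sub>R axis j 1" x] by simp
  define \<psi> where "\<psi> x = C * (1 / \<sigma>\<^sup>2) * ?c * ((1 + norm x)\<^sup>2 * exp (- (1 / (4 * \<sigma>\<^sup>2)) * (norm x)\<^sup>2))" for x :: "real^'q"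
  have \<psi>: "integrable lborel \<psi>"
    unfolding \<psi>_def using \<sigma> by (intro integrable_mult_right integrable_square_exp_neg_norm_square) simp
  have dom: "\<bar>f x\<bar> * \<bar>- ((x + s *\<^sub>R axis j 1) $ j / \<sigma>\<^sup>2) * ?p (x + s *\<^sub>R axis j 1)\<bar> \<le> \<psi> x" if s: "\<bar>s\<bar> \<le> 1" for x s
  proof -
    let ?w = "x + s *\<^sub>R axis j 1 :: real^'q"
    have "\<bar>?w $ j\<bar> \<le> norm ?w" by (rule component_le_norm_cart)
    also have "\<dots> \<le> norm x + norm (s *\<^sub>R axis j 1 :: real^'q)" by (rule norm_triangle_ineq)
    also have "\<dots> \<le> 1 + norm x" using s by simp
    finally have w: "\<bar>?w $ j\<bar> \<le> 1 + norm x" .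
    have "\<bar>f x\<bar> * \<bar>- (?w $ j / \<sigma>\<^sup>2) * ?p ?w\<bar> = \<bar>f x\<bar> * (\<bar>?w $ j\<bar> * (1 / \<sigma>\<^sup>2) * ?p ?w)"
      by (simp add: abs_mult gaussian_density_nonneg)
    also have "\<dots> \<le> (C * (1 + norm x)) * ((1 + norm x) * (1 / \<sigma>\<^sup>2) * (?c * exp (- (1 / (4 * \<sigma>\<^sup>2)) * (norm x)\<^sup>2)))"
      using C[of x] w C0 gaussian_density_translate_le[OF \<sigma> s, of x j]
      by (intro mult_mono) (auto intro!: mult_nonneg_nonneg divide_nonneg_nonneg gaussian_density_nonneg)
    also have "\<dots> = \<psi> x" by (simp add: \<psi>_def power2_eq_square mult_ac)
    finally show ?thesis .
  qed
  have growth: "1 + norm x \<le> (1 + norm x)\<^sup>2" "(1::real) \<le> (1 + norm x)\<^sup>2" for x :: "real^'q"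
    by (simp_all add: power2_eq_square algebra_simps)
  have p_int: "integrable lborel ?p"
    using integrable_gaussian_quadratic_growth[OF \<sigma>, of "\<lambda>_. 1" 1] growth by simp
  have fp_int: "integrable lborel (\<lambda>x. f x * ?p x)"
    using integrable_gaussian_quadratic_growth[OF \<sigma> fm, of C] C growth(1) C0
    by (simp add: mult.commute order_trans[OF C mult_left_mono])
  note ibp = integration_by_parts_direction[OF f_cont lip' G f_der continuous_on_gaussian_density p_int
      gaussian_density_derivative[OF \<sigma>] dom \<psi> fp_int]
  show "integrable lborel (\<lambda>v. ?p v * G v)" using ibp(1) by (simp add: mult.commute)
  have "(\<integral>v. ?p v * G v \<partial>lborel) = - (\<integral>v. f v * (- (v $ j / \<sigma>\<^sup>2) * ?p v) \<partial>lborel)"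
    using ibp(3) by (simp add: mult.commute)
  also have "(\<lambda>v. f v * (- (v $ j / \<sigma>\<^sup>2) * ?p v)) = (\<lambda>v. (- 1 / \<sigma>\<^sup>2) * (?p v * (f v * v $ j)))"
    by (simp add: fun_eq_iff)
  finally show "(\<integral>v. ?p v * G v \<partial>lborel) = (\<integral>v. ?p v * (f v * v $ j) \<partial>lborel) / \<sigma>\<^sup>2"
    by simp
qed

section \<open>The Jacobian of the prediction\<close>

text \<open>An affine formula near \<open>y\<close> also holds near each \<open>y'\<close> close to \<open>y\<close>, so the Jacobian is locally constant.\<close>

lemma jacobian_eq_of_locally_affine:
  fixes f :: "real^'n \<Rightarrow> real^'m"
  assumes "\<forall>\<^sub>F y' in nhds y. f y' = B *v y' + c"
  shows "f differentiable (at y)" and "jacobian f (at y) = B"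
    and "\<forall>\<^sub>F y' in nhds y. jacobian f (at y') = B"
proof -
  have *: "(f has_derivative (\<lambda>h. B *v h)) (at z)" if "\<forall>\<^sub>F y' in nhds z. f y' = B *v y' + c" for z
  proof (rule has_derivative_transform_eventually)
    show "((\<lambda>y'. B *v y' + c) has_derivative (\<lambda>h. B *v h)) (at z)"
      by (rule has_derivative_add_const[OF bounded_linear_imp_has_derivative[OF matrix_vector_mul_bounded_linear]])
    show "\<forall>\<^sub>F y' in at z. B *v y' + c = f y'"
      using that by (auto simp: eventually_at_filter elim: eventually_mono)
    show "B *v z + c = f z" using eventually_nhds_x_imp_x[OF that] by simp
  qed auto
  have J: "jacobian f (at z) = B" if "\<forall>\<^sub>F y' in nhds z. f y' = B *v y' + c" for z
  proof -
    have "frechet_derivative f (at z) = (\<lambda>h. B *v h)"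
      using frechet_derivative_at[OF *[OF that]] by simp
    then show ?thesis by (simp add: jacobian_def)
  qed
  show "f differentiable (at y)" using *[OF assms] by (rule differentiableI)
  show "jacobian f (at y) = B" by (rule J[OF assms])
  have "\<forall>\<^sub>F z in nhds y. \<forall>\<^sub>F y' in nhds z. f y' = B *v y' + c"
    using assms by (simp add: eventually_eventually)
  then show "\<forall>\<^sub>F y' in nhds y. jacobian f (at y') = B"
    by eventually_elim (rule J)
qed

context
  fixes \<Phi> :: "real^'n^'q" and D :: "real^'p^'n" and lam :: real
  assumes lam: "lam > 0" and ker: "matrix_ker \<Phi> \<inter> matrix_ker (transpose D) = {0}"
begin

lemma
  assumes y: "y \<notin> trans_slice \<Phi> D lam"
  shows mu_star_differentiable: "mu_star \<Phi> D lam differentiable (at y)"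
    and jacobian_mu_star: "is_solution \<Phi> D lam y x \<Longrightarrow> cond_H \<Phi> D (cosupport D x) \<Longrightarrow>
      jacobian (mu_star \<Phi> D lam) (at y) = \<Phi> ** A_op \<Phi> D (cosupport D x) ** transpose \<Phi>"
    and jacobian_mu_star_locally_constant:
      "\<forall>\<^sub>F y' in nhds y. jacobian (mu_star \<Phi> D lam) (at y') = jacobian (mu_star \<Phi> D lam) (at y)"
proof -
  show J: "jacobian (mu_star \<Phi> D lam) (at y) = \<Phi> ** A_op \<Phi> D (cosupport D x) ** transpose \<Phi>"
    if x: "is_solution \<Phi> D lam y x" "cond_H \<Phi> D (cosupport D x)" for x
    by (rule mu_star_locally_affine[OF lam y x]) (rule jacobian_eq_of_locally_affine(2))
  obtain x where x: "is_solution \<Phi> D lam y x" "cond_H \<Phi> D (cosupport D x)"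
    using solution_cond_H_exists[OF lam ker] by blast
  obtain c where c: "\<forall>\<^sub>F y' in nhds y.
    mu_star \<Phi> D lam y' = (\<Phi> ** A_op \<Phi> D (cosupport D x) ** transpose \<Phi>) *v y' + c"
    using mu_star_locally_affine[OF lam y x] .
  show "mu_star \<Phi> D lam differentiable (at y)" by (rule jacobian_eq_of_locally_affine(1)[OF c])
  show "\<forall>\<^sub>F y' in nhds y. jacobian (mu_star \<Phi> D lam) (at y') = jacobian (mu_star \<Phi> D lam) (at y)"
    using jacobian_eq_of_locally_affine(3)[OF c] by (simp add: J[OF x])
qed

text \<open>The Jacobian depends on \<open>y\<close> only, while \<open>trace_A_op\<close> identifies its trace with the dimension of
  the cospace of every admissible solution. Hence all these dimensions agree and the
  definite description is meaningful.\<close>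

lemma d_est_eq_trace_jacobian:
  assumes y: "y \<notin> trans_slice \<Phi> D lam"
  shows "real (d_est \<Phi> D lam y) = trace (jacobian (mu_star \<Phi> D lam) (at y))"
proof -
  have dim: "real (dim (cospace D (cosupport D x))) = trace (jacobian (mu_star \<Phi> D lam) (at y))"
    if "is_solution \<Phi> D lam y x" "cond_H \<Phi> D (cosupport D x)" for x
    using jacobian_mu_star[OF y that] trace_A_op[OF that(2)] by simp
  obtain x where x: "is_solution \<Phi> D lam y x" "cond_H \<Phi> D (cosupport D x)"
    using solution_cond_H_exists[OF lam ker] by blast
  have "d_est \<Phi> D lam y = dim (cospace D (cosupport D x))"
    unfolding d_est_def if_not_P[OF y]
  proof (rule the_equality)
    show "\<exists>z. is_solution \<Phi> D lam y z \<and> cond_H \<Phi> D (cosupport D z) \<and>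
       dim (cospace D (cosupport D x)) = dim (cospace D (cosupport D z))" using x by blast
  next
    fix k assume "\<exists>z. is_solution \<Phi> D lam y z \<and> cond_H \<Phi> D (cosupport D z) \<and>
       k = dim (cospace D (cosupport D z))"
    then obtain z where z: "is_solution \<Phi> D lam y z" "cond_H \<Phi> D (cosupport D z)"
      and k: "k = dim (cospace D (cosupport D z))" by blast
    have "real (dim (cospace D (cosupport D z))) = real (dim (cospace D (cosupport D x)))"
      using dim[OF z] dim[OF x] by simp
    then show "k = dim (cospace D (cosupport D x))" using k by simp
  qed
  then show ?thesis using dim[OF x] by simp
qed

lemma mu_star_nonexpansive: "norm (mu_star \<Phi> D lam y - mu_star \<Phi> D lam y') \<le> norm (y - y')"
proof -
  obtain x x' where x: "is_solution \<Phi> D lam y x" "is_solution \<Phi> D lam y' x'"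
    using solution_exists[OF lam ker] by meson
  have "mu_star \<Phi> D lam y = \<Phi> *v x" "mu_star \<Phi> D lam y' = \<Phi> *v x'"
    using x by (auto intro!: mu_star_eq less_imp_le[OF lam])
  then show ?thesis using solution_image_nonexpansive[OF less_imp_le[OF lam] x] by simp
qed

lemma continuous_on_jacobian_mu_star:
  "continuous_on (- trans_slice \<Phi> D lam) (\<lambda>y. jacobian (mu_star \<Phi> D lam) (at y))"
proof (intro continuous_at_imp_continuous_on ballI)
  fix y assume "y \<in> - trans_slice \<Phi> D lam"
  then have "\<forall>\<^sub>F y' in nhds y. jacobian (mu_star \<Phi> D lam) (at y') = jacobian (mu_star \<Phi> D lam) (at y)"
    by (intro jacobian_mu_star_locally_constant) simp
  then have "\<forall>\<^sub>F y' in at y. jacobian (mu_star \<Phi> D lam) (at y') = jacobian (mu_star \<Phi> D lam) (at y)"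
    by (auto simp: eventually_at_filter elim: eventually_mono)
  then show "isCont (\<lambda>y. jacobian (mu_star \<Phi> D lam) (at y)) y"
    unfolding isCont_def by (rule tendsto_eventually)
qed

lemma has_weak_jacobian_mu_star:
  "has_weak_jacobian (mu_star \<Phi> D lam) (\<lambda>y. jacobian (mu_star \<Phi> D lam) (at y))"
  by (rule has_weak_jacobian_Lipschitz[of _ 1 "trans_slice \<Phi> D lam"])
    (use mu_star_nonexpansive closed_trans_slice[OF less_imp_le[OF lam]]
       negligible_trans_slice[OF less_imp_le[OF lam]] mu_star_differentiable
       continuous_on_jacobian_mu_star in auto)

section \<open>The risk formulas\<close>

lemma gsure_Phi_eq:
  assumes y: "y \<notin> trans_slice \<Phi> D lam"
  shows "gsure_Phi \<sigma> \<Phi> D lam y =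
    (norm (y - mu_star \<Phi> D lam y))\<^sup>2 - real CARD('q) * \<sigma>\<^sup>2 + 2 * \<sigma>\<^sup>2 * real (d_est \<Phi> D lam y)"
  by (simp add: gsure_Phi_def gsure_def transpose_mat trace_I d_est_eq_trace_jacobian[OF y])

text \<open>For \<open>B = \<Phi>\<^sup>T (\<Phi> \<Phi>\<^sup>T)\<^sup>+\<close> the Penrose equations give \<open>B\<^sup>T B = (\<Phi> \<Phi>\<^sup>T)\<^sup>+\<close>; the rest is cyclicity of
  the trace.\<close>

lemma gsure_Pi_eq:
  assumes y: "y \<notin> trans_slice \<Phi> D lam" and x: "is_solution \<Phi> D lam y x"
    and x': "is_solution \<Phi> D lam y x'" and H: "cond_H \<Phi> D (cosupport D x')"
  shows "gsure_Pi \<sigma> \<Phi> D lam y =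
    (norm ((transpose \<Phi> ** pinv (\<Phi> ** transpose \<Phi>)) *v y - proj_Pi \<Phi> *v x))\<^sup>2
    - \<sigma>\<^sup>2 * trace (pinv (\<Phi> ** transpose \<Phi>))
    + 2 * \<sigma>\<^sup>2 * trace (proj_Pi \<Phi> ** A_op \<Phi> D (cosupport D x'))"
proof -
  let ?S = "\<Phi> ** transpose \<Phi>"
  let ?P = "pinv ?S"
  let ?B = "transpose \<Phi> ** ?P"
  let ?A = "A_op \<Phi> D (cosupport D x')"
  have S: "transpose ?S = ?S" by (simp add: matrix_transpose_mul)
  have BB: "transpose ?B ** ?B = ?P"
    using pinv_mult_mult[OF S] by (simp add: matrix_transpose_mul pinv_symmetric[OF S] matrix_mul_assoc)
  have "trace (?B ** (\<Phi> ** ?A ** transpose \<Phi>) ** transpose ?B)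
      = trace (transpose ?B ** ?B ** (\<Phi> ** ?A ** transpose \<Phi>))"
    by (subst trace_mul_sym) (simp add: matrix_mul_assoc)
  also have "\<dots> = trace ((?P ** \<Phi> ** ?A) ** transpose \<Phi>)"
    unfolding BB by (simp add: matrix_mul_assoc)
  also have "\<dots> = trace (proj_Pi \<Phi> ** ?A)"
    by (subst trace_mul_sym) (simp add: proj_Pi_def matrix_mul_assoc)
  finally have tr: "trace (?B ** (\<Phi> ** ?A ** transpose \<Phi>) ** transpose ?B) = trace (proj_Pi \<Phi> ** ?A)" .
  have "?B *v (y - mu_star \<Phi> D lam y) = ?B *v y - proj_Pi \<Phi> *v x"
    by (simp add: mu_star_eq[OF less_imp_le[OF lam] x] matrix_vector_mult_diff_distrib proj_Pi_def
        flip: matrix_vector_mul_assoc)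
  then show ?thesis
    unfolding gsure_Pi_def gsure_def BB jacobian_mu_star[OF y x' H] tr by simp
qed

text \<open>Here \<open>B = (\<Phi>\<^sup>T \<Phi>)\<^sup>-\<^sup>1 \<Phi>\<^sup>T\<close> is a left inverse of \<open>\<Phi>\<close>, so conjugating \<open>\<Phi> A \<Phi>\<^sup>T\<close> by \<open>B\<close> gives back \<open>A\<close>.\<close>

lemma gsure_Id_eq:
  assumes y: "y \<notin> trans_slice \<Phi> D lam" and x: "is_solution \<Phi> D lam y x"
    and x': "is_solution \<Phi> D lam y x'" and H: "cond_H \<Phi> D (cosupport D x')"
    and rank: "rank \<Phi> = CARD('n)"
  shows "gsure_Id \<sigma> \<Phi> D lam y =
    (norm ((matrix_inv (transpose \<Phi> ** \<Phi>) ** transpose \<Phi>) *v y - x))\<^sup>2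
    - \<sigma>\<^sup>2 * trace (matrix_inv (transpose \<Phi> ** \<Phi>))
    + 2 * \<sigma>\<^sup>2 * trace (A_op \<Phi> D (cosupport D x'))"
proof -
  let ?S = "transpose \<Phi> ** \<Phi>"
  let ?R = "matrix_inv ?S"
  let ?B = "?R ** transpose \<Phi>"
  let ?A = "A_op \<Phi> D (cosupport D x')"
  have "z = 0" if "?S *v z = 0" for z
  proof -
    have "(\<Phi> *v z) \<bullet> (\<Phi> *v z) = (?S *v z) \<bullet> z"
      by (simp add: inner_transpose_mult flip: matrix_vector_mul_assoc)
    then have "\<Phi> *v z = \<Phi> *v 0" using that by simp
    then show "z = 0" using rank unfolding full_rank_injective by (rule injD[rotated])
  qed
  then have "invertible ?S"
    unfolding invertible_left_inverse matrix_left_invertible_ker by blast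
  then have inv: "?S ** ?R = mat 1" "?R ** ?S = mat 1"
    using someI_ex[of "\<lambda>R. ?S ** R = mat 1 \<and> R ** ?S = mat 1"]
    by (auto simp: matrix_inv_def invertible_def)
  have S: "transpose ?S = ?S" by (simp add: matrix_transpose_mul)
  have RT: "?S ** transpose ?R = mat 1"
    using arg_cong[OF inv(2), of transpose] by (simp add: matrix_transpose_mul transpose_mat matrix_mul_assoc)
  have B\<Phi>: "?B ** \<Phi> = mat 1" using inv(2) by (simp add: matrix_mul_assoc)
  have B\<Phi>': "transpose \<Phi> ** transpose ?B = mat 1"
    using arg_cong[OF B\<Phi>, of transpose] by (simp add: matrix_transpose_mul transpose_mat)
  have "trace (transpose ?B ** ?B) = trace (?B ** transpose ?B)" by (rule trace_mul_sym)
  also have "?B ** transpose ?B = ?R ** (transpose \<Phi> ** transpose ?B)" by (simp only: matrix_mul_assoc)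
  also have "\<dots> = ?R" unfolding B\<Phi>' by simp
  finally have t1: "trace (transpose ?B ** ?B) = trace ?R" .
  have "?B ** (\<Phi> ** ?A ** transpose \<Phi>) ** transpose ?B = (?B ** \<Phi>) ** ?A ** (transpose \<Phi> ** transpose ?B)"
    by (simp only: matrix_mul_assoc)
  then have t2: "?B ** (\<Phi> ** ?A ** transpose \<Phi>) ** transpose ?B = ?A"
    unfolding B\<Phi> B\<Phi>' by simp
  have "?B *v (\<Phi> *v x) = x" by (simp only: matrix_vector_mul_assoc B\<Phi> matrix_vector_mul_lid)
  then have "?B *v (y - mu_star \<Phi> D lam y) = ?B *v y - x"
    by (simp only: mu_star_eq[OF less_imp_le[OF lam] x] matrix_vector_mult_diff_distrib)
  then show ?thesis
    unfolding gsure_Id_def gsure_def t1 jacobian_mu_star[OF y x' H] t2 by simp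
qed

section \<open>Degrees of freedom\<close>

text \<open>The diagonal entries of the Jacobian, with the value 0 on the slice. This is the
  convention of \<open>d_est\<close>, so that the sum of these terms equals \<open>d_est\<close> everywhere, and it makes them Borel
  measurable.\<close>

definition divergence_term :: "'q \<Rightarrow> real^'q \<Rightarrow> real" where
  "divergence_term i y =
    (if y \<in> trans_slice \<Phi> D lam then 0 else jacobian (mu_star \<Phi> D lam) (at y) $ i $ i)"

lemma borel_measurable_divergence_term: "divergence_term i \<in> borel_measurable borel"
  unfolding divergence_term_def[abs_def] using closed_trans_slice[OF less_imp_le[OF lam], of \<Phi> D]
  by (intro borel_measurable_continuous_on_if continuous_intros continuous_on_jacobian_mu_star) auto

lemma d_est_eq_sum_divergence_terms: "real (d_est \<Phi> D lam y) = (\<Sum>i\<in>UNIV. divergence_term i y)"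
proof (cases "y \<in> trans_slice \<Phi> D lam")
  case True
  then show ?thesis by (simp add: d_est_def divergence_term_def)
next
  case False
  then show ?thesis by (simp add: d_est_eq_trace_jacobian trace_def divergence_term_def)
qed

lemma mu_star_component_Lipschitz:
  "\<bar>mu_star \<Phi> D lam (a + v) $ i - mu_star \<Phi> D lam (a + v') $ i\<bar> \<le> 1 * norm (v - v')"
proof -
  have "\<bar>(mu_star \<Phi> D lam (a + v) - mu_star \<Phi> D lam (a + v')) $ i\<bar>
      \<le> norm (mu_star \<Phi> D lam (a + v) - mu_star \<Phi> D lam (a + v'))"
    by (rule component_le_norm_cart)
  also have "\<dots> \<le> norm (v - v')" using mu_star_nonexpansive[of "a + v" "a + v'"] by simp
  finally show ?thesis by simp
qed

lemma borel_measurable_mu_star_translate: "(\<lambda>v. mu_star \<Phi> D lam (a + v) $ i) \<in> borel_measurable borel"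
proof (rule borel_measurable_continuous_onI, rule lipschitz_on_continuous_on)
  show "1-lipschitz_on UNIV (\<lambda>v. mu_star \<Phi> D lam (a + v) $ i)"
    using mu_star_component_Lipschitz[of a _ i] by (auto simp: lipschitz_on_def dist_norm)
qed

lemma AE_divergence_term_derivative:
  "AE v in lborel. ((\<lambda>s. mu_star \<Phi> D lam (a + (v + s *\<^sub>R axis i 1)) $ i)
     has_real_derivative divergence_term i (a + v)) (at 0)"
proof -
  have "negligible ((+) (- a) ` trans_slice \<Phi> D lam)"
    using negligible_trans_slice[OF less_imp_le[OF lam]] by (rule negligible_translation)
  then have "AE v in lebesgue. v \<notin> (+) (- a) ` trans_slice \<Phi> D lam"
    by (intro AE_not_in) (simp add: negligible_iff_null_sets)
  then have "AE v in lborel. v \<notin> (+) (- a) ` trans_slice \<Phi> D lam"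
    by (simp add: AE_completion_iff)
  then show ?thesis
  proof eventually_elim
    case (elim v)
    have notin: "a + v \<notin> trans_slice \<Phi> D lam"
    proof
      assume "a + v \<in> trans_slice \<Phi> D lam"
      then have "- a + (a + v) \<in> (+) (- a) ` trans_slice \<Phi> D lam" by (rule imageI)
      then show False using elim by simp
    qed
    show ?case
      using jacobian_entry_derivative[OF mu_star_differentiable[OF notin], of i i] notin
      by (simp add: divergence_term_def add.assoc)
  qed
qed

lemma stein_mu_star:
  assumes \<sigma>: "\<sigma> > 0"
  shows "integrable lborel (\<lambda>v. gaussian_density \<sigma> v * divergence_term i (a + v))"
    and "(\<integral>v. gaussian_density \<sigma> v * divergence_term i (a + v) \<partial>lborel)
       = (\<integral>v. gaussian_density \<sigma> v * (mu_star \<Phi> D lam (a + v) $ i * v $ i) \<partial>lborel) / \<sigma>\<^sup>2"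
proof -
  have m: "(\<lambda>v. divergence_term i (a + v)) \<in> borel_measurable borel"
    using measurable_compose[OF _ borel_measurable_divergence_term, of "\<lambda>v. a + v" borel i] by simp
  note stein = stein_identity[OF \<sigma> mu_star_component_Lipschitz zero_le_one m AE_divergence_term_derivative]
  show "integrable lborel (\<lambda>v. gaussian_density \<sigma> v * divergence_term i (a + v))" by (rule stein(1))
  show "(\<integral>v. gaussian_density \<sigma> v * divergence_term i (a + v) \<partial>lborel)
       = (\<integral>v. gaussian_density \<sigma> v * (mu_star \<Phi> D lam (a + v) $ i * v $ i) \<partial>lborel) / \<sigma>\<^sup>2"
    by (rule stein(2))
qed

end

lemma
  assumes wn: "white_noise M \<sigma> w" and g: "g \<in> borel_measurable borel"
  shows white_noise_integrable_iff:
      "integrable M (\<lambda>\<omega>. g (w \<omega>) :: real) \<longleftrightarrow> integrable lborel (\<lambda>v. gaussian_density \<sigma> v * g v)"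
    and white_noise_expectation:
      "(\<integral>\<omega>. g (w \<omega>) \<partial>M) = (\<integral>v. gaussian_density \<sigma> v * g v \<partial>lborel)"
proof -
  have d: "distributed M lborel w (\<lambda>v. ennreal (gaussian_density \<sigma> v))"
    using wn by (simp add: white_noise_def gaussian_density_def)
  show "integrable M (\<lambda>\<omega>. g (w \<omega>)) \<longleftrightarrow> integrable lborel (\<lambda>v. gaussian_density \<sigma> v * g v)"
    using distributed_integrable[OF d, of g] g by (simp add: gaussian_density_nonneg)
  show "(\<integral>\<omega>. g (w \<omega>) \<partial>M) = (\<integral>v. gaussian_density \<sigma> v * g v \<partial>lborel)"
    using distributed_integral[OF d, of g] g by (simp add: gaussian_density_nonneg)
qed

lemma white_noise_integrable_quadratic_growth:
  fixes g :: "real^'q \<Rightarrow> real"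
  assumes "white_noise M \<sigma> w" "\<sigma> > 0" "g \<in> borel_measurable borel" "\<And>v. \<bar>g v\<bar> \<le> C * (1 + norm v)\<^sup>2"
  shows "integrable M (\<lambda>\<omega>. g (w \<omega>))"
  using integrable_gaussian_quadratic_growth[OF assms(2-4)] white_noise_integrable_iff[OF assms(1,3)] by simp

text \<open>Stein's identity for the constant function 1.\<close>

lemma white_noise_component_mean:
  fixes w :: "'a \<Rightarrow> real^'q"
  assumes wn: "white_noise M \<sigma> w" and \<sigma>: "\<sigma> > 0"
  shows "(\<integral>\<omega>. w \<omega> $ i \<partial>M) = 0"
proof -
  have "(\<integral>v. gaussian_density \<sigma> (v::real^'q) * 0 \<partial>lborel)
      = (\<integral>v. gaussian_density \<sigma> v * (1 * (v::real^'q) $ i) \<partial>lborel) / \<sigma>\<^sup>2"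
    by (rule stein_identity(2)[OF \<sigma>, where f = "\<lambda>_. 1" and G = "\<lambda>_. 0" and L = 0 and j = i]) auto
  then show ?thesis
    using \<sigma> white_noise_expectation[OF wn, of "\<lambda>v. v $ i"] by simp
qed

text \<open>Since the noise is centred, the covariance is the expectation of \<open>w\<^sub>i\<close> times the \<open>i\<close>-th
  component of the prediction, which by Stein's identity is \<open>\<sigma>\<^sup>2\<close> times the expectation of the
  \<open>i\<close>-th diagonal entry of the Jacobian. The noise and the prediction grow at most linearly, so their products are integrable.\<close>

lemma degrees_of_freedom_mu_star:
  fixes \<Phi> :: "real^'n^'q" and D :: "real^'p^'n" and a :: "real^'q" and w :: "'a \<Rightarrow> real^'q"
  assumes \<sigma>: "\<sigma> > 0" and lam: "lam > 0"
    and ker: "matrix_ker \<Phi> \<inter> matrix_ker (transpose D) = {0}"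
    and M: "prob_space M" and wn: "white_noise M \<sigma> w"
  shows "covariance_exists M (\<lambda>\<omega>. (a + w \<omega>) $ i) (\<lambda>\<omega>. mu_star \<Phi> D lam (a + w \<omega>) $ i)"
    and "unbiased_estimator M (\<lambda>\<omega>. real (d_est \<Phi> D lam (a + w \<omega>)))
      (degrees_of_freedom M \<sigma> (\<lambda>\<omega>. a + w \<omega>) (mu_star \<Phi> D lam))"
proof -
  interpret prob_space M by fact
  let ?mu = "mu_star \<Phi> D lam"
  let ?f = "\<lambda>i v. ?mu (a + v) $ i"
  have fm[measurable]: "?f i \<in> borel_measurable borel" for i
    by (rule borel_measurable_mu_star_translate[OF lam ker])
  define C where "C = norm (?mu a) + 1"
  have C: "C \<ge> 1" by (simp add: C_def)
  have f_bd: "\<bar>?f i v\<bar> \<le> C * (1 + norm v)" for i v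
  proof -
    have "\<bar>?f i v - ?f i 0\<bar> \<le> norm v"
      using mu_star_component_Lipschitz[OF lam ker, of a v i 0] by simp
    moreover have "\<bar>?f i 0\<bar> \<le> norm (?mu a)" using component_le_norm_cart[of "?mu a" i] by simp
    ultimately have "\<bar>?f i v\<bar> \<le> norm (?mu a) + norm v" by linarith
    also have "\<dots> \<le> C * (1 + norm v)" by (simp add: C_def algebra_simps)
    finally show ?thesis .
  qed
  have sq: "1 + norm v \<le> (1 + norm v)\<^sup>2" for v :: "real^'q"
    by (simp add: power2_eq_square algebra_simps)
  have w_bd: "\<bar>v $ i\<bar> \<le> 1 + norm v" for v :: "real^'q" and i
    using component_le_norm_cart[of v i] by simp
  have int_w: "integrable M (\<lambda>\<omega>. w \<omega> $ i)" for i
    by (rule white_noise_integrable_quadratic_growth[OF wn \<sigma>, of "\<lambda>v. v $ i" 1])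
      (use order_trans[OF w_bd sq] in auto)
  have int_f: "integrable M (\<lambda>\<omega>. ?f i (w \<omega>))" for i
  proof (rule white_noise_integrable_quadratic_growth[OF wn \<sigma> fm])
    show "\<bar>?f i v\<bar> \<le> C * (1 + norm v)\<^sup>2" for v
      using f_bd[of v i] mult_left_mono[OF sq[of v], of C] C by linarith
  qed
  have wf_m: "(\<lambda>v. ?f i v * v $ i) \<in> borel_measurable borel" for i by measurable
  have int_wf: "integrable M (\<lambda>\<omega>. ?f i (w \<omega>) * w \<omega> $ i)" for i
  proof (rule white_noise_integrable_quadratic_growth[OF wn \<sigma> wf_m])
    show "\<bar>?f i v * v $ i\<bar> \<le> C * (1 + norm v)\<^sup>2" for v
      using mult_mono[OF f_bd[of v i] w_bd[of v i]] C
      by (simp add: abs_mult power2_eq_square mult.assoc)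
  qed
  have int_prod: "integrable M (\<lambda>\<omega>. (a + w \<omega>) $ i * ?f i (w \<omega>))" for i
  proof -
    have "integrable M (\<lambda>\<omega>. a $ i * ?f i (w \<omega>) + ?f i (w \<omega>) * w \<omega> $ i)"
      using int_f int_wf by auto
    then show ?thesis by (simp add: algebra_simps)
  qed
  show "covariance_exists M (\<lambda>\<omega>. (a + w \<omega>) $ i) (\<lambda>\<omega>. ?mu (a + w \<omega>) $ i)"
    using int_w int_f int_prod by (simp add: covariance_exists_def)
  have Ew: "(\<integral>\<omega>. w \<omega> $ i \<partial>M) = 0" for i by (rule white_noise_component_mean[OF wn \<sigma>])
  have cov: "covariance M (\<lambda>\<omega>. (a + w \<omega>) $ i) (\<lambda>\<omega>. ?f i (w \<omega>)) = (\<integral>\<omega>. ?f i (w \<omega>) * w \<omega> $ i \<partial>M)" for i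
  proof -
    let ?E = "\<integral>\<omega>. ?f i (w \<omega>) \<partial>M"
    have EX: "(\<integral>\<omega>. (a + w \<omega>) $ i \<partial>M) = a $ i" using int_w Ew by (simp add: prob_space)
    have "covariance M (\<lambda>\<omega>. (a + w \<omega>) $ i) (\<lambda>\<omega>. ?f i (w \<omega>)) = (\<integral>\<omega>. ?f i (w \<omega>) * w \<omega> $ i - ?E * w \<omega> $ i \<partial>M)"
      unfolding covariance_def EX by (simp add: algebra_simps)
    also have "\<dots> = (\<integral>\<omega>. ?f i (w \<omega>) * w \<omega> $ i \<partial>M)"
      using int_wf int_w Ew by simp
    finally show ?thesis .
  qed
  let ?d = "divergence_term \<Phi> D lam"
  have dm: "(\<lambda>v. ?d i (a + v)) \<in> borel_measurable borel" for i
    using measurable_compose[OF _ borel_measurable_divergence_term[OF lam ker], of "\<lambda>v. a + v" borel i] by simp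
  have int_d: "integrable M (\<lambda>\<omega>. ?d i (a + w \<omega>))" for i
    using stein_mu_star(1)[OF lam ker \<sigma>] white_noise_integrable_iff[OF wn dm] by blast
  have E_d: "(\<integral>\<omega>. ?d i (a + w \<omega>) \<partial>M) = (\<integral>\<omega>. ?f i (w \<omega>) * w \<omega> $ i \<partial>M) / \<sigma>\<^sup>2" for i
    unfolding white_noise_expectation[OF wn dm] white_noise_expectation[OF wn wf_m]
    by (rule stein_mu_star(2)[OF lam ker \<sigma>])
  have "integrable M (\<lambda>\<omega>. \<Sum>i\<in>UNIV. ?d i (a + w \<omega>))" using int_d by auto
  moreover have "(\<integral>\<omega>. (\<Sum>i\<in>UNIV. ?d i (a + w \<omega>)) \<partial>M)
      = degrees_of_freedom M \<sigma> (\<lambda>\<omega>. a + w \<omega>) ?mu"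
    unfolding degrees_of_freedom_def cov using int_d by (simp add: E_d)
  ultimately show "unbiased_estimator M (\<lambda>\<omega>. real (d_est \<Phi> D lam (a + w \<omega>)))
      (degrees_of_freedom M \<sigma> (\<lambda>\<omega>. a + w \<omega>) ?mu)"
    by (simp add: unbiased_estimator_def d_est_eq_sum_divergence_terms[OF lam ker])
qed

theorem corollary1:
  fixes \<Phi> :: "real^'n^'q"
    and D :: "real^'p^'n"
    and x0 :: "real^'n"
    and \<sigma> lam :: real
    and M :: "'a measure"
    and w :: "'a \<Rightarrow> real^'q"
  assumes "\<sigma> > 0"
    and "lam > 0"
    and "matrix_ker \<Phi> \<inter> matrix_ker (transpose D) = {0}"
    and "prob_space M"
    and "white_noise M \<sigma> w"
  shows "weakly_differentiable (mu_star \<Phi> D lam)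
    \<and> has_weak_jacobian (mu_star \<Phi> D lam) (\<lambda>y. jacobian (mu_star \<Phi> D lam) (at y))
    \<and> (\<forall>y. y \<notin> trans_slice \<Phi> D lam \<longrightarrow>
         mu_star \<Phi> D lam differentiable (at y)
         \<and> gsure_Phi \<sigma> \<Phi> D lam y =
             (norm (y - mu_star \<Phi> D lam y))\<^sup>2 - real CARD('q) * \<sigma>\<^sup>2
             + 2 * \<sigma>\<^sup>2 * real (d_est \<Phi> D lam y)
         \<and> (\<forall>x x' J.
              is_solution \<Phi> D lam y x \<and> is_solution \<Phi> D lam y x' \<and>
              J = cosupport D x' \<and> cond_H \<Phi> D J \<longrightarrow>
                gsure_Pi \<sigma> \<Phi> D lam y =
                  (norm ((transpose \<Phi> ** pinv (\<Phi> ** transpose \<Phi>)) *v y - proj_Pi \<Phi> *v x))\<^sup>2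
                  - \<sigma>\<^sup>2 * trace (pinv (\<Phi> ** transpose \<Phi>))
                  + 2 * \<sigma>\<^sup>2 * trace (proj_Pi \<Phi> ** A_op \<Phi> D J)
                \<and> (rank \<Phi> = CARD('n) \<longrightarrow>
                   gsure_Id \<sigma> \<Phi> D lam y =
                     (norm ((matrix_inv (transpose \<Phi> ** \<Phi>) ** transpose \<Phi>) *v y - x))\<^sup>2
                     - \<sigma>\<^sup>2 * trace (matrix_inv (transpose \<Phi> ** \<Phi>))
                     + 2 * \<sigma>\<^sup>2 * trace (A_op \<Phi> D J))))
    \<and> (\<forall>i. covariance_exists M (\<lambda>\<omega>. (\<Phi> *v x0 + w \<omega>) $ i)
                                (\<lambda>\<omega>. mu_star \<Phi> D lam (\<Phi> *v x0 + w \<omega>) $ i))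
    \<and> unbiased_estimator M (\<lambda>\<omega>. real (d_est \<Phi> D lam (\<Phi> *v x0 + w \<omega>)))
        (degrees_of_freedom M \<sigma> (\<lambda>\<omega>. \<Phi> *v x0 + w \<omega>) (mu_star \<Phi> D lam))"
proof (intro conjI allI impI)
  note weak = has_weak_jacobian_mu_star[OF assms(2,3)]
  show "weakly_differentiable (mu_star \<Phi> D lam)"
    using weak unfolding weakly_differentiable_def by blast
  show "has_weak_jacobian (mu_star \<Phi> D lam) (\<lambda>y. jacobian (mu_star \<Phi> D lam) (at y))" by (rule weak)
next
  fix y assume y: "y \<notin> trans_slice \<Phi> D lam"
  show "mu_star \<Phi> D lam differentiable (at y)" by (rule mu_star_differentiable[OF assms(2,3) y])
  show "gsure_Phi \<sigma> \<Phi> D lam y = (norm (y - mu_star \<Phi> D lam y))\<^sup>2 - real CARD('q) * \<sigma>\<^sup>2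
             + 2 * \<sigma>\<^sup>2 * real (d_est \<Phi> D lam y)"
    by (rule gsure_Phi_eq[OF assms(2,3) y])
  fix x x' J
  assume *: "is_solution \<Phi> D lam y x \<and> is_solution \<Phi> D lam y x' \<and> J = cosupport D x' \<and> cond_H \<Phi> D J"
  then have x: "is_solution \<Phi> D lam y x" "is_solution \<Phi> D lam y x'" "cond_H \<Phi> D (cosupport D x')"
    and J: "J = cosupport D x'" by auto
  show "gsure_Pi \<sigma> \<Phi> D lam y =
      (norm ((transpose \<Phi> ** pinv (\<Phi> ** transpose \<Phi>)) *v y - proj_Pi \<Phi> *v x))\<^sup>2
      - \<sigma>\<^sup>2 * trace (pinv (\<Phi> ** transpose \<Phi>)) + 2 * \<sigma>\<^sup>2 * trace (proj_Pi \<Phi> ** A_op \<Phi> D J)"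
    unfolding J by (rule gsure_Pi_eq[OF assms(2,3) y x])
  show "gsure_Id \<sigma> \<Phi> D lam y =
      (norm ((matrix_inv (transpose \<Phi> ** \<Phi>) ** transpose \<Phi>) *v y - x))\<^sup>2
      - \<sigma>\<^sup>2 * trace (matrix_inv (transpose \<Phi> ** \<Phi>)) + 2 * \<sigma>\<^sup>2 * trace (A_op \<Phi> D J)"
    if "rank \<Phi> = CARD('n)"
    unfolding J by (rule gsure_Id_eq[OF assms(2,3) y x that])
next
  fix i
  show "covariance_exists M (\<lambda>\<omega>. (\<Phi> *v x0 + w \<omega>) $ i)
                                (\<lambda>\<omega>. mu_star \<Phi> D lam (\<Phi> *v x0 + w \<omega>) $ i)"
    by (rule degrees_of_freedom_mu_star(1)[OF assms])
next
  show "unbiased_estimator M (\<lambda>\<omega>. real (d_est \<Phi> D lam (\<Phi> *v x0 + w \<omega>)))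
        (degrees_of_freedom M \<sigma> (\<lambda>\<omega>. \<Phi> *v x0 + w \<omega>) (mu_star \<Phi> D lam))"
    by (rule degrees_of_freedom_mu_star(2)[OF assms])
qed

end
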